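(* If $1\le\xi<\omega_1$ and $X$ is a complex HI$_\xi$ Banach space, then every $T\in\mathcal{L}(X)$ can be written as $T=\lambda I+S$, where $\lambda\in\mathbb{C}$ and $S\in\mathcal{SS}_\xi(X)$.
   Context: $\mathbb{N}=\{1,2,\dots\}$; $\mathcal{L}(X)$ is the space of bounded linear operators on $X$ and $I$ is the identity; $\#$ denotes cardinality; $[x_i]_{i\in F}$ is the closed linear span of $\{x_i\}_{i\in F}$. For finite sets $A,B\subseteq\mathbb{N}$, $A<B$ means $\max A<\min B$, and $n\le A$ means $n\le\min A$ (the empty set satisfies all such relations). Schreier families. For families $\mathcal{F},\mathcal{G}$ of finite subsets of $\mathbb{N}$ put $\mathcal{F}[\mathcal{G}]=\{\bigcup_{i=1}^n G_i : n\in\mathbb{N},\ G_1<\dots<G_n,\ G_i\in\mathcal{G}\text{ for } i\le n,\ \{\min G_i\}_{i=1}^n\in\mathcal{F}\}$. Let $\mathcal{S}_0=\{\{n\}:n\in\mathbb{N}\}\cup\{\varnothing\}$, $\mathcal{S}_1=\{F\subseteq\mathbb{N}\text{ finite}: \#F\le\min F\}$ (including $\varnothing$), $\mathcal{S}_{\xi+1}=\mathcal{S}_1[\mathcal{S}_\xi]$, and for a countable limit ordinal $\xi$ fix a sequence of ordinals $\xi_n\nearrow\xi$ and let $\mathcal{S}_\xi=\{F: n\le F\text{ and }F\in\mathcal{S}_{\xi_n}\text{ for some }n\in\mathbb{N}\}$. A Banach space $X$ is $\mathcal{S}_\xi$-hereditarily indecomposable (HI$_\xi$) if for every $\varepsilon>0$,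 every infinite-dimensional subspace $Y\subseteq X$ and every basic sequence $(x_n)$ in $X$ there exist $F\in\mathcal{S}_\xi$ and a unit vector $y\in Y$ with $\mathrm{dist}(y,[x_i]_{i\in F})<\varepsilon$. $T\in\mathcal{L}(X)$ is $\mathcal{S}_\xi$-strictly singular, $T\in\mathcal{SS}_\xi(X)$, if for every $\varepsilon>0$ and every basic sequence $(x_n)$ in $X$ there exist $F\in\mathcal{S}_\xi$ and $z\in[x_i]_{i\in F}\setminus\{0\}$ with $\|Tz\|\le\varepsilon\|z\|$. *)

theory Defs
  imports "HOL-Analysis.Analysis" "HOL-Library.Countable_Set_Type"
begin

section \<open>Countable ordinals\<close>

text \<open>The elements of the least uncountable well-order are the countable ordinals: each
  \<open>\<xi>\<close> stands for the order type of its initial segment \<open>{..<\<xi>}\<close>.\<close>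

typedef omega1 = "Field (cardSuc natLeq)"
proof -
  have "infinite (Field (cardSuc natLeq))"
    using cardSuc_finite[OF natLeq_Card_order] infinite_UNIV_nat by (simp only: Field_natLeq simp_thms)
  then show ?thesis
    by (metis ex_in_conv finite.emptyI)
qed

instantiation omega1 :: wellorder
begin

definition less_eq_omega1 :: "omega1 \<Rightarrow> omega1 \<Rightarrow> bool" where
  "less_eq_omega1 x y \<longleftrightarrow> (Rep_omega1 x, Rep_omega1 y) \<in> cardSuc natLeq"

definition less_omega1 :: "omega1 \<Rightarrow> omega1 \<Rightarrow> bool" where
  "less_omega1 x y \<longleftrightarrow> x \<le> y \<and> \<not> y \<le> x"

instance
proof -
  let ?r = "cardSuc natLeq"
  have wo: "Well_order ?r"
    using cardSuc_Card_order[OF natLeq_Card_order] by (rule card_order_on_well_order_on)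
  then have lin: "refl_on (Field ?r) ?r" "trans ?r" "antisym ?r" "total_on (Field ?r) ?r"
    and wf: "wf (?r - Id)"
    by (auto simp: well_order_on_def linear_order_on_def partial_order_on_def preorder_on_def)
  have refl: "x \<le> x" for x :: omega1
    using lin(1) Rep_omega1[of x] by (simp add: less_eq_omega1_def refl_onD)
  have anti: "x = y" if "x \<le> y" "y \<le> x" for x y :: omega1
    using that lin(3) by (metis Rep_omega1_inject antisymD less_eq_omega1_def)
  have tot: "x \<le> y \<or> y \<le> x" for x y :: omega1
    using lin(4) Rep_omega1[of x] Rep_omega1[of y] refl[of x]
    by (metis Rep_omega1_inject less_eq_omega1_def total_on_def)
  have "wf (inv_image (?r - Id) Rep_omega1)"
    using wf by (rule wf_inv_image)
  moreover have "{(x, y). x < y} \<subseteq> inv_image (?r - Id) Rep_omega1"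
    by (auto simp: less_omega1_def less_eq_omega1_def inv_image_def)
  ultimately have wf': "wf {(x :: omega1, y). x < y}"
    by (rule wf_subset)
  show "OFCLASS(omega1, wellorder_class)"
  proof
    show "x \<le> z" if "x \<le> y" "y \<le> z" for x y z :: omega1
      using that lin(2) unfolding less_eq_omega1_def by (blast dest: transD)
    show "P a" if "\<And>x. (\<And>y. y < x \<Longrightarrow> P y) \<Longrightarrow> P x" for P and a :: omega1
      using wf' by (rule wf_induct_rule) (use that in auto)
  qed (use refl anti tot less_omega1_def in auto)
qed

end

lemma countable_lessThan_omega1: "countable {..<\<xi> :: omega1}"
  including cardinal_syntax
proof -
  let ?r = "cardSuc natLeq"
  have "|underS ?r (Rep_omega1 \<xi>)| <o ?r"
    using cardSuc_Card_order[OF natLeq_Card_order] Rep_omega1 by (rule card_of_underS)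
  then have "|underS ?r (Rep_omega1 \<xi>)| \<le>o natLeq"
    using cardSuc_ordLeq_ordLess[OF natLeq_Card_order card_of_Card_order] by blast
  then have "countable (underS ?r (Rep_omega1 \<xi>))"
    using countable_card_le_natLeq by blast
  then have "countable (Rep_omega1 ` {..<\<xi>})"
    by (rule countable_subset[rotated])
      (auto simp: underS_def less_omega1_def less_eq_omega1_def Rep_omega1_inject)
  then show ?thesis
    by (metis Rep_omega1_inject countable_image_inj_on inj_onI)
qed

lemma uncountable_omega1: "uncountable (UNIV :: omega1 set)"
  including cardinal_syntax
proof
  let ?r = "cardSuc natLeq"
  assume "countable (UNIV :: omega1 set)"
  then have "countable (range Rep_omega1)"
    by (rule countable_image)
  then have "countable (Field ?r)"
    by (metis type_definition.Rep_range type_definition_omega1)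
  then have "|Field ?r| \<le>o natLeq"
    using countable_card_le_natLeq by blast
  moreover have "natLeq <o |Field ?r|"
    by (metis cardSuc_Card_order cardSuc_greater card_of_Field_ordIso natLeq_Card_order
        ordIso_symmetric ordLess_ordIso_trans)
  ultimately show False
    using not_ordLess_ordLeq by blast
qed

instantiation omega1 :: "{zero, one}"
begin

definition zero_omega1 :: omega1 where
  "0 = (LEAST \<xi>::omega1. True)"

definition one_omega1 :: omega1 where
  "1 = (LEAST \<xi>::omega1. 0 < \<xi>)"

instance ..

end

definition osuc :: "omega1 \<Rightarrow> omega1" where
  "osuc \<xi> = (LEAST \<eta>. \<xi> < \<eta>)"

lemma zero_le_omega1: "0 \<le> (\<xi> :: omega1)"
  by (simp add: zero_omega1_def Least_le)

lemma one_omega1_eq: "1 = osuc 0"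
  by (simp add: one_omega1_def osuc_def)

lemma less_osuc: "\<xi> < osuc \<xi>"
proof -
  have "countable {..\<xi>}"
    using countable_lessThan_omega1[of \<xi>] ivl_disj_un_singleton(2)[of \<xi>]
    by (metis countable_Un countable_finite finite.emptyI finite_insert)
  then have "{..\<xi>} \<noteq> UNIV"
    using uncountable_omega1 by metis
  then have "\<exists>\<eta>. \<xi> < \<eta>"
    by (metis UNIV_eq_I atMost_iff not_le)
  then show ?thesis
    unfolding osuc_def by (rule LeastI_ex)
qed

lemma osuc_le_iff: "osuc \<xi> \<le> \<eta> \<longleftrightarrow> \<xi> < \<eta>"
  by (metis Least_le less_osuc order_less_le_trans osuc_def)

definition limit_ordinal :: "omega1 \<Rightarrow> bool" where
  "limit_ordinal \<xi> \<longleftrightarrow> \<xi> \<noteq> 0 \<and> (\<forall>\<eta>. \<xi> \<noteq> osuc \<eta>)"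

text \<open>A choice of \<open>\<xi>\<^sub>n \<nearrow> \<xi>\<close> (\<open>n \<ge> 1\<close>) for every countable limit ordinal \<open>\<xi>\<close>; the values
  \<open>\<sigma> \<xi> 0\<close>, and \<open>\<sigma> \<xi>\<close> for non-limit \<open>\<xi>\<close>, play no role.\<close>

definition fundamental_system :: "(omega1 \<Rightarrow> nat \<Rightarrow> omega1) \<Rightarrow> bool" where
  "fundamental_system \<sigma> \<longleftrightarrow>
    (\<forall>\<xi>. limit_ordinal \<xi> \<longrightarrow>
       strict_mono_on {1..} (\<sigma> \<xi>) \<and> (\<forall>n\<ge>1. \<sigma> \<xi> n < \<xi>) \<and> (\<forall>\<eta><\<xi>. \<exists>n\<ge>1. \<eta> < \<sigma> \<xi> n))"

lemma fundamental_system_exists: "\<exists>\<sigma>. fundamental_system \<sigma>"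
proof -
  have "\<exists>s. strict_mono_on {1..} s \<and> (\<forall>n\<ge>1. s n < \<xi>) \<and> (\<forall>\<eta><\<xi>. \<exists>n\<ge>(1::nat). \<eta> < s n)"
    if lim: "limit_ordinal \<xi>" for \<xi>
  proof -
    have closed: "osuc \<eta> < \<xi>" if "\<eta> < \<xi>" for \<eta>
      using lim that osuc_le_iff unfolding limit_ordinal_def by (metis order_le_neq_trans)
    have ne: "{..<\<xi>} \<noteq> {}"
      using lim zero_le_omega1 unfolding limit_ordinal_def by (metis empty_iff lessThan_iff order_le_neq_trans)
    define e where "e = from_nat_into {..<\<xi>}"
    have e: "range e = {..<\<xi>}"
      unfolding e_def using ne countable_lessThan_omega1 by (rule range_from_nat_into)
    then have e_less: "e n < \<xi>" for n
      by blast
    define s where "s = rec_nat (e 0) (\<lambda>n x. max (osuc x) (osuc (e n)))"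
    have s_Suc: "s (Suc n) = max (osuc (s n)) (osuc (e n))" for n
      by (simp add: s_def)
    have "strict_mono s"
      by (rule strict_monoI_Suc) (simp add: s_Suc less_max_iff_disj less_osuc)
    moreover have "s n < \<xi>" for n
    proof (induction n)
      case 0
      show ?case
        using e_less by (simp add: s_def)
    next
      case (Suc n)
      then show ?case
        using e_less closed by (simp add: s_Suc)
    qed
    moreover have "\<exists>n\<ge>1. \<eta> < s n" if "\<eta> < \<xi>" for \<eta>
    proof -
      have "\<eta> \<in> range e"
        unfolding e using that by simp
      then obtain n where "\<eta> = e n"
        by (rule rangeE)
      then have "\<eta> < s (Suc n)"
        by (simp add: s_Suc less_max_iff_disj less_osuc)
      then show ?thesis
        by (intro exI[of _ "Suc n"]) simp
    qed
    ultimately show ?thesis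
      by (intro exI[of _ s]) (auto simp: strict_mono_on_def strict_mono_def)
  qed
  then obtain \<sigma> where "\<forall>\<xi>. limit_ordinal \<xi> \<longrightarrow> strict_mono_on {1..} (\<sigma> \<xi>) \<and> (\<forall>n\<ge>1. \<sigma> \<xi> n < \<xi>)
      \<and> (\<forall>\<eta><\<xi>. \<exists>n\<ge>(1::nat). \<eta> < \<sigma> \<xi> n)"
    by metis
  then show ?thesis
    unfolding fundamental_system_def by blast
qed


section \<open>Schreier families\<close>

definition set_less :: "nat set \<Rightarrow> nat set \<Rightarrow> bool" where
  "set_less A B \<longleftrightarrow> (\<forall>a\<in>A. \<forall>b\<in>B. a < b)"

text \<open>The families consist of finite subsets of \<open>{1, 2, \<dots>}\<close>. Some \<open>G\<^sub>i\<close> may be empty: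
  \<open>G\<^sub>1 < \<dots> < G\<^sub>n\<close> is read pairwise and empty \<open>G\<^sub>i\<close> contribute nothing to the set of minima.\<close>

definition family_comp :: "nat set set \<Rightarrow> nat set set \<Rightarrow> nat set set" where
  "family_comp \<F> \<G> =
    {\<Union>i\<in>{1..n}. G i | (n::nat) G. 1 \<le> n \<and> (\<forall>i\<in>{1..n}. \<forall>j\<in>{1..n}. i < j \<longrightarrow> set_less (G i) (G j)) \<and>
       (\<forall>i\<in>{1..n}. G i \<in> \<G>) \<and> {Min (G i) | i. i \<in> {1..n} \<and> G i \<noteq> {}} \<in> \<F>}"

lemma family_comp_mono:
  assumes "\<And>G. P G \<longrightarrow> Q G"
  shows "F \<in> family_comp \<F> {G. P G} \<longrightarrow> F \<in> family_comp \<F> {G. Q G}"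
  using assms unfolding family_comp_def by blast

definition schreier_zero :: "nat set set" where
  "schreier_zero = {{n} | n. 1 \<le> n} \<union> {{}}"

text \<open>For nonempty \<open>F\<close> the condition forces \<open>0 \<notin> F\<close>.\<close>

definition schreier_one :: "nat set set" where
  "schreier_one = {F. finite F \<and> (F \<noteq> {} \<longrightarrow> card F \<le> Min F)}"

text \<open>The transfinite recursion defining the Schreier families, as an inductive definition so
  that it makes sense for an arbitrary \<open>\<sigma>\<close>. The clause for \<open>0 + 1\<close> is separate, since the
  family with index 1 is given outright.\<close>

inductive in_schreier :: "(omega1 \<Rightarrow> nat \<Rightarrow> omega1) \<Rightarrow> omega1 \<Rightarrow> nat set \<Rightarrow> bool"
  for \<sigma> :: "omega1 \<Rightarrow> nat \<Rightarrow> omega1" where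
  zero: "F \<in> schreier_zero \<Longrightarrow> in_schreier \<sigma> 0 F"
| one: "F \<in> schreier_one \<Longrightarrow> in_schreier \<sigma> 1 F"
| succ: "1 \<le> \<xi> \<Longrightarrow> F \<in> family_comp schreier_one {G. in_schreier \<sigma> \<xi> G} \<Longrightarrow>
    in_schreier \<sigma> (osuc \<xi>) F"
| limit: "limit_ordinal \<xi> \<Longrightarrow> 1 \<le> n \<Longrightarrow> \<forall>k\<in>F. n \<le> k \<Longrightarrow> in_schreier \<sigma> (\<sigma> \<xi> n) F \<Longrightarrow>
    in_schreier \<sigma> \<xi> F"
  monos family_comp_mono

definition schreier :: "(omega1 \<Rightarrow> nat \<Rightarrow> omega1) \<Rightarrow> omega1 \<Rightarrow> nat set set" where
  "schreier \<sigma> \<xi> = {F. in_schreier \<sigma> \<xi> F}"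


section \<open>Complex Banach spaces\<close>

class complex_normed_vector = real_normed_vector +
  fixes scaleC :: "complex \<Rightarrow> 'a \<Rightarrow> 'a" (infixr \<open>*\<^sub>C\<close> 75)
  assumes scaleC_add_right: "a *\<^sub>C (x + y) = a *\<^sub>C x + a *\<^sub>C y"
    and scaleC_add_left: "(a + b) *\<^sub>C x = a *\<^sub>C x + b *\<^sub>C x"
    and scaleC_scaleC: "a *\<^sub>C (b *\<^sub>C x) = (a * b) *\<^sub>C x"
    and scaleC_of_real: "complex_of_real r *\<^sub>C x = r *\<^sub>R x"
    and norm_scaleC: "norm (a *\<^sub>C x) = cmod a * norm x"

class cbanach = complex_normed_vector + banach

instantiation complex :: cbanach
begin

definition scaleC_complex :: "complex \<Rightarrow> complex \<Rightarrow> complex" where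
  "scaleC_complex a x = a * x"

instance
  by standard
    (simp_all add: scaleC_complex_def algebra_simps norm_mult scaleR_conv_of_real)

end

global_interpretation complex_vector:
  vector_space "scaleC :: complex \<Rightarrow> 'a::complex_normed_vector \<Rightarrow> 'a"
  defines csubspace = complex_vector.subspace
    and cspan = complex_vector.span
proof
  show "1 *\<^sub>C x = x" for x :: 'a
    using scaleC_of_real[of 1 x] by simp
qed (simp_all add: scaleC_add_right scaleC_add_left scaleC_scaleC)

definition bounded_clinear :: "('a::complex_normed_vector \<Rightarrow> 'b::complex_normed_vector) \<Rightarrow> bool" where
  "bounded_clinear T \<longleftrightarrow> bounded_linear T \<and> (\<forall>a x. T (a *\<^sub>C x) = a *\<^sub>C T x)"

definition closed_cspan :: "'a::complex_normed_vector set \<Rightarrow> 'a set" where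
  "closed_cspan A = closure (cspan A)"

definition infinite_dimensional :: "'a::complex_normed_vector set \<Rightarrow> bool" where
  "infinite_dimensional Y \<longleftrightarrow> (\<nexists>B. finite B \<and> Y \<subseteq> cspan B)"

text \<open>A basic sequence is a Schauder basis of its closed linear span. Sequences are indexed by
  \<open>{1, 2, \<dots>}\<close>, the ground set of the Schreier families: the vector \<open>x 0\<close> is ignored.\<close>

definition basic_sequence :: "(nat \<Rightarrow> 'a::complex_normed_vector) \<Rightarrow> bool" where
  "basic_sequence x \<longleftrightarrow>
    (\<forall>y \<in> closed_cspan (x ` {1..}). \<exists>!a. (\<lambda>n. a n *\<^sub>C x (Suc n)) sums y)"


section \<open>Hereditary indecomposability and strict singularity\<close>

definition schreier_HI ::
    "(omega1 \<Rightarrow> nat \<Rightarrow> omega1) \<Rightarrow> omega1 \<Rightarrow> 'a::cbanach itself \<Rightarrow> bool" where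
  "schreier_HI \<sigma> \<xi> _ \<longleftrightarrow>
    (\<forall>\<epsilon>>0. \<forall>Y :: 'a set. \<forall>x :: nat \<Rightarrow> 'a.
       csubspace Y \<and> infinite_dimensional Y \<and> basic_sequence x \<longrightarrow>
       (\<exists>F \<in> schreier \<sigma> \<xi>. \<exists>y \<in> Y. norm y = 1 \<and> infdist y (closed_cspan (x ` F)) < \<epsilon>))"

text \<open>It makes no difference whether subspaces are required to be closed.\<close>

lemma csubspace_closure:
  fixes Y :: "'a::complex_normed_vector set"
  assumes "csubspace Y"
  shows "csubspace (closure Y)"
proof (rule complex_vector.subspaceI)
  show "0 \<in> closure Y"
    using assms complex_vector.subspace_0 closure_subset by blast
next
  fix x y
  assume "x \<in> closure Y" "y \<in> closure Y"
  then obtain u v where u: "\<forall>n. u n \<in> Y" "u \<longlonglongrightarrow> x" and v: "\<forall>n. v n \<in> Y" "v \<longlonglongrightarrow> y"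
    unfolding closure_sequential by blast
  have "\<forall>n. u n + v n \<in> Y"
    using u(1) v(1) assms complex_vector.subspace_add by blast
  then show "x + y \<in> closure Y"
    unfolding closure_sequential using tendsto_add[OF u(2) v(2)]
    by (intro exI[of _ "\<lambda>n. u n + v n"]) simp
next
  fix c x
  assume "x \<in> closure Y"
  then obtain u where u: "\<forall>n. u n \<in> Y" "u \<longlonglongrightarrow> x"
    unfolding closure_sequential by blast
  have "bounded_linear (\<lambda>x :: 'a. c *\<^sub>C x)"
  proof (rule bounded_linear_intro)
    show "c *\<^sub>C (r *\<^sub>R x) = r *\<^sub>R (c *\<^sub>C x)" for r and x :: 'a
      by (simp add: scaleC_of_real[symmetric] scaleC_scaleC mult.commute)
    show "norm (c *\<^sub>C x) \<le> norm x * cmod c" for x :: 'a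
      by (simp add: norm_scaleC)
  qed (rule scaleC_add_right)
  then have "(\<lambda>n. c *\<^sub>C u n) \<longlonglongrightarrow> c *\<^sub>C x"
    using u(2) by (rule bounded_linear.tendsto)
  moreover have "\<forall>n. c *\<^sub>C u n \<in> Y"
    using u(1) assms complex_vector.subspace_scale by blast
  ultimately show "c *\<^sub>C x \<in> closure Y"
    unfolding closure_sequential by (intro exI[of _ "\<lambda>n. c *\<^sub>C u n"]) simp
qed

lemma schreier_HI_iff_closed:
  "schreier_HI \<sigma> \<xi> TYPE('a::cbanach) \<longleftrightarrow>
    (\<forall>\<epsilon>>0. \<forall>Y :: 'a set. \<forall>x :: nat \<Rightarrow> 'a.
       csubspace Y \<and> closed Y \<and> infinite_dimensional Y \<and> basic_sequence x \<longrightarrow>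
       (\<exists>F \<in> schreier \<sigma> \<xi>. \<exists>y \<in> Y. norm y = 1 \<and> infdist y (closed_cspan (x ` F)) < \<epsilon>))"
  (is "_ \<longleftrightarrow> ?R")
proof
  show ?R if "schreier_HI \<sigma> \<xi> TYPE('a)"
    using that unfolding schreier_HI_def by blast
next
  assume R: ?R
  show "schreier_HI \<sigma> \<xi> TYPE('a)"
    unfolding schreier_HI_def
  proof (intro allI impI, elim conjE)
    fix \<epsilon> :: real and Y :: "'a set" and x :: "nat \<Rightarrow> 'a"
    assume "\<epsilon> > 0" and Y: "csubspace Y" "infinite_dimensional Y" and "basic_sequence x"
    moreover have "infinite_dimensional (closure Y)"
      using Y(2) closure_subset unfolding infinite_dimensional_def by blast
    ultimately obtain F y where F: "F \<in> schreier \<sigma> \<xi>" and y: "y \<in> closure Y" "norm y = 1"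
      and dist: "infdist y (closed_cspan (x ` F)) < \<epsilon>"
      using R csubspace_closure closed_closure by metis
    obtain u where u: "\<forall>n. u n \<in> Y" "u \<longlonglongrightarrow> y"
      using y(1) unfolding closure_sequential by blast
    have sgn: "(\<lambda>n. sgn (u n)) \<longlonglongrightarrow> sgn y"
      using u(2) y(2) by (intro tendsto_sgn) auto
    have "sgn y = y"
      using y(2) by (simp add: sgn_div_norm)
    then have "(\<lambda>n. infdist (sgn (u n)) (closed_cspan (x ` F))) \<longlonglongrightarrow>
        infdist y (closed_cspan (x ` F))"
      using tendsto_infdist[OF sgn] by metis
    then have "\<forall>\<^sub>F n in sequentially. infdist (sgn (u n)) (closed_cspan (x ` F)) < \<epsilon>"
      using dist by (rule order_tendstoD)
    moreover have "\<forall>\<^sub>F n in sequentially. u n \<noteq> 0"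
      using u(2) y(2) by (intro tendsto_imp_eventually_ne) auto
    ultimately have "\<forall>\<^sub>F n in sequentially.
        infdist (sgn (u n)) (closed_cspan (x ` F)) < \<epsilon> \<and> u n \<noteq> 0"
      by (rule eventually_conj)
    then obtain n where n: "infdist (sgn (u n)) (closed_cspan (x ` F)) < \<epsilon>" "u n \<noteq> 0"
      using eventually_happens'[OF sequentially_bot] by blast
    have "sgn (u n) = complex_of_real (inverse (norm (u n))) *\<^sub>C u n"
      by (simp only: scaleC_of_real sgn_div_norm)
    then have "sgn (u n) \<in> Y"
      using u(1) Y(1) complex_vector.subspace_scale by metis
    moreover have "norm (sgn (u n)) = 1"
      using n(2) by (simp add: norm_sgn)
    ultimately show "\<exists>F \<in> schreier \<sigma> \<xi>. \<exists>y \<in> Y. norm y = 1 \<and>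
        infdist y (closed_cspan (x ` F)) < \<epsilon>"
      using F n(1) by blast
  qed
qed

definition schreier_SS ::
    "(omega1 \<Rightarrow> nat \<Rightarrow> omega1) \<Rightarrow> omega1 \<Rightarrow> ('a::cbanach \<Rightarrow> 'a) set" where
  "schreier_SS \<sigma> \<xi> =
    {T. bounded_clinear T \<and>
      (\<forall>\<epsilon>>0. \<forall>x. basic_sequence x \<longrightarrow>
         (\<exists>F \<in> schreier \<sigma> \<xi>. \<exists>z \<in> closed_cspan (x ` F) - {0}. norm (T z) \<le> \<epsilon> * norm z))}"

end

theory Submission
  imports Defs "HOL-Computational_Algebra.Fundamental_Theorem_Algebra" "HOL-Library.Ramsey"
begin


text \<open>The scalar is found by asking where \<open>T - \<lambda>I\<close> is small. Call an operator almost null if it maps some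
bounded separated sequences to sequences of arbitrarily small diameter. An almost null operator \<open>S\<close>
is as small as desired on suitable infinite-dimensional subspaces
(\<open>almost_null_subspace\<close>). In an HI\<open>\<^sub>\<xi>\<close> space this makes \<open>S\<close> strictly singular of
order \<open>\<xi>\<close>: for a basic sequence \<open>x\<close>, a unit vector \<open>y\<close> of such a subspace lies close
to some \<open>z \<in> [x\<^sub>i]\<^bsub>i\<in>F\<^esub>\<close> with \<open>F\<close> in the Schreier family, and \<open>S z\<close> is small
because \<open>S y\<close> is (\<open>schreier_SS_of_almost_null\<close>). So it remains to see that on every
infinite-dimensional complex normed space some \<open>T - \<lambda>I\<close> is almost null.

Let \<open>\<chi>\<close> be the Hausdorff measure of noncompactness and let the lower modulus \<open>q(S)\<close> be the largest
constant with \<open>q(S) \<chi>(M) \<le> \<chi>(S M)\<close> for all bounded \<open>M\<close>. It satisfies \<open>q(A) q(B) \<le> q(A B)\<close>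
and \<open>q(A) \<le> q(B) + \<parallel>A - B\<parallel>\<close>, and \<open>q(S) = 0\<close> forces \<open>S\<close> to be almost null.
For polynomials in \<open>T\<close> these inequalities, with \<open>q(c I) = \<bar>c\<bar>\<close>, produce a \<open>\<lambda>\<close> with \<open>q(T - \<lambda>I) = 0\<close>
(\<open>exists_zero\<close>). The reason is a minimum principle for
\<open>l(\<lambda>) = sup\<^sub>j q((T - \<lambda>I)\<^sup>j)\<^bsup>1/j\<^esup>\<close>. If \<open>q(T - \<lambda>I) > 0\<close> for every \<open>\<lambda>\<close>, then \<open>l\<close> attains a
minimum \<open>m > 0\<close>; let \<open>\<lambda>\<^sub>0\<close> be a minimum point with the largest real part. The factors
of \<open>(T - \<lambda>\<^sub>0I)\<^sup>n - m\<^sup>nI\<close> are \<open>T - \<mu>I\<close> for \<open>n\<close> equidistant points \<open>\<mu>\<close> of the circle with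
radius \<open>m\<close> about \<open>\<lambda>\<^sub>0\<close>. Its lower modulus is at most \<open>2 m\<^sup>n\<close>. Grouping neighbouring
factors bounds it below by a product with almost \<open>m\<close> per factor everywhere, and with
more than \<open>m\<close> per factor on an arc near the rightmost point \<open>\<lambda>\<^sub>0 + m\<close>, where \<open>l > m\<close>. For large
\<open>n\<close> the two bounds contradict each other.

Small subspaces come from the separated sequences of an almost null operator: differences
of their members can be chosen almost orthogonal to any compact set
(\<open>exists_almost_orthogonal_difference\<close>), which yields a sequence with uniformly bounded
coefficients whose images decrease geometrically.\<close>

section \<open>Zeros of supermultiplicative functions on complex polynomials\<close>

lemma prod_linear_roots_unity:
  fixes z a :: complex
  assumes "n > 0"
  shows "(\<Prod>i<n. z - a * cis (2 * pi * real i / real n)) = z ^ n - a ^ n"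
proof (cases "a = 0")
  case False
  define p :: "complex poly" where "p = monom 1 n - 1"
  have deg: "degree p = n" and lc: "lead_coeff p = 1"
  proof -
    have "degree p = degree (monom (1::complex) n + (- 1))"
      by (simp add: p_def)
    also have "\<dots> = n"
      using assms by (subst degree_add_eq_left) (auto simp: degree_monom_eq)
    finally show d: "degree p = n" .
    show "lead_coeff p = 1"
      unfolding d using assms by (simp add: p_def coeff_1)
  qed
  have "rsquarefree p"
    unfolding rsquarefree_roots using assms
    by (auto simp: p_def poly_monom pderiv_diff pderiv_monom power_0_left)
  then have "(\<Prod>w | poly p w = 0. [:- w, 1:]) = p"
    using complex_poly_decompose_rsquarefree[of p] lc by simp
  then have "poly p (z / a) = poly (\<Prod>w | poly p w = 0. [:- w, 1:]) (z / a)"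
    by simp
  also have "\<dots> = (\<Prod>w | w ^ n = 1. z / a - w)"
    by (simp add: poly_prod p_def poly_monom)
  also have "\<dots> = (\<Prod>i<n. z / a - cis (2 * pi * real i / real n))"
    by (rule prod.reindex_bij_betw[symmetric]) (rule Complex.bij_betw_roots_unity[OF assms])
  finally have *: "(z / a) ^ n - 1 = (\<Prod>i<n. z / a - cis (2 * pi * real i / real n))"
    by (simp add: p_def poly_monom)
  have "(\<Prod>i<n. z - a * cis (2 * pi * real i / real n))
      = (\<Prod>i<n. a * (z / a - cis (2 * pi * real i / real n)))"
    using False by (intro prod.cong) (auto simp: field_simps)
  also have "\<dots> = a ^ n * ((z / a) ^ n - 1)"
    by (simp add: prod.distrib *)
  also have "\<dots> = z ^ n - a ^ n"
    using False by (simp add: right_diff_distrib power_divide)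
  finally show ?thesis .
qed (use assms in simp)

lemma power_diff_eq_prod_linear:
  fixes l a :: complex
  assumes "n > 0"
  shows "[:- l, 1:] ^ n - [:a ^ n:]
    = (\<Prod>i<n. [:- (l + a * cis (2 * pi * real i / real n)), 1:])"
proof -
  have "poly ([:- l, 1:] ^ n - [:a ^ n:]) z
      = poly (\<Prod>i<n. [:- (l + a * cis (2 * pi * real i / real n)), 1:]) z" for z
    using prod_linear_roots_unity[OF assms, of "z - l" a]
    by (simp add: poly_prod algebra_simps)
  then show ?thesis
    by (subst poly_eq_poly_eq_iff[symmetric]) (rule ext)
qed

text \<open>The properties shared by \<open>p \<mapsto> q(p(T))\<close> and \<open>p \<mapsto> \<parallel>p(T)\<parallel>\<close> when \<open>q\<close> is a lower
modulus on operators. The constant polynomials play the role of the scalar operators.\<close>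

locale poly_modulus =
  fixes Q N :: "complex poly \<Rightarrow> real"
  assumes Q_nonneg: "0 \<le> Q p"
    and Q_mult: "Q p * Q r \<le> Q (p * r)"
    and Q_diff: "Q p \<le> Q r + N (p - r)"
    and Q_const: "cmod c \<le> Q [:c:]"
    and Q_zero: "Q 0 = 0"
    and N_nonneg: "0 \<le> N p"
    and N_add: "N (p + r) \<le> N p + N r"
    and N_mult: "N (p * r) \<le> N p * N r"
    and N_const: "N [:c:] \<le> cmod c"
begin

lemma N_uminus: "N (- p) \<le> N p"
proof -
  have "N (- p) = N ([:-1:] * p)" by simp
  also have "\<dots> \<le> N [:-1:] * N p" by (rule N_mult)
  also have "\<dots> \<le> 1 * N p"
    using N_const[of "-1"] N_nonneg by (intro mult_right_mono) auto
  finally show ?thesis by simp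
qed

lemma Q_le_N: "Q p \<le> N p"
  using Q_diff[of p 0] by (simp add: Q_zero)

lemma Q_prod: "(\<Prod>i<n. Q (f i)) \<le> Q (\<Prod>i<n. f i)" for n :: nat
proof (induction n)
  case 0
  show ?case using Q_const[of 1] by (simp add: one_pCons)
next
  case (Suc n)
  have "(\<Prod>i<Suc n. Q (f i)) \<le> Q (\<Prod>i<n. f i) * Q (f n)"
    using Suc Q_nonneg by (auto intro: mult_right_mono)
  also have "\<dots> \<le> Q (\<Prod>i<Suc n. f i)"
    using Q_mult by simp
  finally show ?case .
qed

lemma Q_linear_ge: "cmod \<nu> - N [:0, 1:] \<le> Q [:- \<nu>, 1:]"
proof -
  have "cmod \<nu> \<le> Q [:- \<nu>:]" using Q_const[of "- \<nu>"] by simp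
  also have "\<dots> \<le> Q [:- \<nu>, 1:] + N ([:- \<nu>:] - [:- \<nu>, 1:])" by (rule Q_diff)
  also have "N ([:- \<nu>:] - [:- \<nu>, 1:]) \<le> N [:0, 1:]"
    using N_uminus[of "[:0, 1:]"] by simp
  finally show ?thesis by simp
qed

lemma N_power: "N (p ^ n) \<le> N p ^ n"
proof (induction n)
  case 0
  show ?case using N_const[of 1] by (simp add: one_pCons)
next
  case (Suc n)
  have "N (p ^ Suc n) \<le> N p * N (p ^ n)" using N_mult by simp
  also have "\<dots> \<le> N p * N p ^ n" using Suc N_nonneg by (intro mult_left_mono) auto
  finally show ?case by simp
qed

text \<open>Products of linear factors depend continuously on their roots, here at the point where all roots
coincide.\<close>

lemma prod_linear_near_power:
  assumes "e > 0"
  shows "\<exists>r>0. \<forall>w. (\<forall>i<n. w i \<in> ball \<nu> r) \<longrightarrow>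
    N ((\<Prod>i<n. [:- w i, 1:]) - [:- \<nu>, 1:] ^ n) < e"
  using assms
proof (induction n arbitrary: e)
  case 0
  show ?case using 0 N_const[of 0] by (intro exI[of _ 1]) simp
next
  case (Suc n)
  let ?A = "N [:- \<nu>, 1:]" and ?B = "N ([:- \<nu>, 1:] ^ n)"
  have A: "?A + 1 > 0" and B: "?B + 1 > 0"
    using N_nonneg[of "[:- \<nu>, 1:]"] N_nonneg[of "[:- \<nu>, 1:] ^ n"] by auto
  define e1 where "e1 = e / (2 * (?A + 1))"
  have "e1 > 0" using Suc.prems A by (simp add: e1_def)
  then obtain r1 where r1: "r1 > 0" and
    *: "\<And>w. (\<forall>i<n. w i \<in> ball \<nu> r1) \<Longrightarrow> N ((\<Prod>i<n. [:- w i, 1:]) - [:- \<nu>, 1:] ^ n) < e1"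
    using Suc.IH by meson
  define r where "r = min r1 (min 1 (e / (2 * (?B + 1))))"
  have "r > 0" using r1 Suc.prems B by (simp add: r_def)
  moreover have "N ((\<Prod>i<Suc n. [:- w i, 1:]) - [:- \<nu>, 1:] ^ Suc n) < e"
    if w: "\<forall>i<Suc n. w i \<in> ball \<nu> r" for w
  proof -
    let ?P = "\<Prod>i<n. [:- w i, 1:]"
    have d: "cmod (\<nu> - w n) < r" using w by (simp add: dist_norm)
    have N1: "N (?P - [:- \<nu>, 1:] ^ n) < e1"
      by (rule *) (use w in \<open>auto simp: r_def\<close>)
    have N2: "N [:\<nu> - w n:] \<le> cmod (\<nu> - w n)" by (rule N_const)
    have "[:- w n, 1:] = [:- \<nu>, 1:] + [:\<nu> - w n:]" by simp
    then have N3: "N [:- w n, 1:] \<le> ?A + 1"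
      using N_add[of "[:- \<nu>, 1:]" "[:\<nu> - w n:]"] N2 d by (simp add: r_def)
    have eq: "(\<Prod>i<Suc n. [:- w i, 1:]) - [:- \<nu>, 1:] ^ Suc n
        = (?P - [:- \<nu>, 1:] ^ n) * [:- w n, 1:] + [:- \<nu>, 1:] ^ n * [:\<nu> - w n:]"
    proof -
      have s: "[:\<nu> - w n:] = [:- w n, 1:] - [:- \<nu>, 1:]" by simp
      show ?thesis unfolding s by (simp only: prod.lessThan_Suc power_Suc) (simp only: algebra_simps)
    qed
    have "N ((\<Prod>i<Suc n. [:- w i, 1:]) - [:- \<nu>, 1:] ^ Suc n)
        \<le> N (?P - [:- \<nu>, 1:] ^ n) * N [:- w n, 1:] + ?B * N [:\<nu> - w n:]"
      unfolding eq using N_add N_mult by (meson add_mono order_trans)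
    also have "\<dots> \<le> N (?P - [:- \<nu>, 1:] ^ n) * (?A + 1) + ?B * cmod (\<nu> - w n)"
      using N2 N3 N_nonneg by (intro add_mono mult_left_mono) auto
    also have "\<dots> < e1 * (?A + 1) + e / 2"
    proof (rule add_less_le_mono)
      show "N (?P - [:- \<nu>, 1:] ^ n) * (?A + 1) < e1 * (?A + 1)"
        using N1 A by (intro mult_strict_right_mono)
      have "?B * cmod (\<nu> - w n) \<le> (?B + 1) * (e / (2 * (?B + 1)))"
        using d B N_nonneg by (intro mult_mono) (auto simp: r_def)
      also have "\<dots> = e / 2" using B by (metis nonzero_mult_divide_mult_cancel_left less_irrefl mult.commute times_divide_eq_right)
      finally show "?B * cmod (\<nu> - w n) \<le> e / 2" .
    qed
    also have "\<dots> = e" using A by (simp add: e1_def field_simps)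
    finally show ?thesis .
  qed
  ultimately show ?case by blast
qed

text \<open>The lower bound that survives regrouping: it holds for arbitrary roots in \<open>B\<close>, so \<open>j\<close>
neighbouring roots on a circle may be treated like a \<open>j\<close>-fold root.\<close>

definition large_on :: "real \<Rightarrow> nat \<Rightarrow> complex set \<Rightarrow> bool" where
  "large_on c j B \<longleftrightarrow> (\<forall>w. (\<forall>i<j. w i \<in> B) \<longrightarrow> c ^ j \<le> Q (\<Prod>i<j. [:- w i, 1:]))"

text \<open>The points where \<open>sup\<^sub>j Q((X - \<nu>)\<^sup>j)\<^bsup>1/j\<^esup>\<close> is larger than \<open>c\<close>.\<close>

definition exceeds :: "real \<Rightarrow> complex set" where
  "exceeds c = {\<nu>. \<exists>j\<ge>1. c ^ j < Q ([:- \<nu>, 1:] ^ j)}"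

lemma exceedsE:
  assumes "\<nu> \<in> exceeds c"
  obtains j r where "j \<ge> 1" "r > 0"
    "\<And>w. (\<forall>i<j. w i \<in> ball \<nu> r) \<Longrightarrow> c ^ j < Q (\<Prod>i<j. [:- w i, 1:])"
proof -
  obtain j where j: "j \<ge> 1" "c ^ j < Q ([:- \<nu>, 1:] ^ j)"
    using assms by (auto simp: exceeds_def)
  then obtain r where r: "r > 0" "\<And>w. (\<forall>i<j. w i \<in> ball \<nu> r) \<Longrightarrow>
      N ((\<Prod>i<j. [:- w i, 1:]) - [:- \<nu>, 1:] ^ j) < Q ([:- \<nu>, 1:] ^ j) - c ^ j"
    using prod_linear_near_power[of "Q ([:- \<nu>, 1:] ^ j) - c ^ j" j \<nu>] by auto
  have "c ^ j < Q (\<Prod>i<j. [:- w i, 1:])" if "\<forall>i<j. w i \<in> ball \<nu> r" for w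
  proof -
    let ?P = "\<Prod>i<j. [:- w i, 1:]"
    have "Q ([:- \<nu>, 1:] ^ j) \<le> Q ?P + N (- (?P - [:- \<nu>, 1:] ^ j))"
      using Q_diff[of "[:- \<nu>, 1:] ^ j" ?P] by simp
    then show ?thesis using N_uminus[of "?P - [:- \<nu>, 1:] ^ j"] r(2)[OF that] by linarith
  qed
  then show ?thesis using that j r by blast
qed

lemma open_exceeds: "open (exceeds c)"
  unfolding open_contains_ball
proof
  fix \<nu> assume "\<nu> \<in> exceeds c"
  then obtain j r where j: "j \<ge> 1" "r > 0"
    and *: "\<And>w. (\<forall>i<j. w i \<in> ball \<nu> r) \<Longrightarrow> c ^ j < Q (\<Prod>i<j. [:- w i, 1:])"
    by (rule exceedsE) metis
  have "\<mu> \<in> exceeds c" if "\<mu> \<in> ball \<nu> r" for \<mu>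
    using *[of "\<lambda>_. \<mu>"] that j by (auto simp: exceeds_def)
  then show "\<exists>e>0. ball \<nu> e \<subseteq> exceeds c" using j by blast
qed

lemma exceeds_antimono: "0 \<le> c \<Longrightarrow> c \<le> d \<Longrightarrow> exceeds d \<subseteq> exceeds c"
  unfolding exceeds_def by (auto dest: power_mono intro: le_less_trans)

lemma Q_blocks:
  fixes w :: "nat \<Rightarrow> complex"
  shows "(\<Prod>g<k. Q (\<Prod>i<j. [:- w (i + g * j), 1:])) \<le> Q (\<Prod>i<k * j. [:- w i, 1:])"
proof -
  have "(\<Prod>g<k. Q (\<Prod>i<j. [:- w (i + g * j), 1:]))
      \<le> Q (\<Prod>g<k. \<Prod>i<j. [:- w (i + g * j), 1:])"
    by (rule Q_prod)
  also have "(\<Prod>g<k. \<Prod>i<j. [:- w (i + g * j), 1:]) = (\<Prod>g<k. \<Prod>i=g*j..<g*j+j. [:- w i, 1:])"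
  proof (rule prod.cong[OF refl])
    fix g
    show "(\<Prod>i<j. [:- w (i + g * j), 1:]) = (\<Prod>i=g*j..<g*j+j. [:- w i, 1:])"
      using prod.shift_bounds_nat_ivl[of "\<lambda>i. [:- w i, 1:]" 0 "g * j" j]
      by (simp add: add.commute atLeast0LessThan)
  qed
  also have "\<dots> = (\<Prod>i<k * j. [:- w i, 1:])"
    by (rule prod.nat_group)
  finally show ?thesis .
qed

lemma block_index_less: "i + g * j < k * j" if "g < k" "i < j" for i g j k :: nat
  using that mult_le_mono1[of "Suc g" k j] by simp

lemma large_onD: "large_on c j B \<Longrightarrow> (\<And>i. i < j \<Longrightarrow> w i \<in> B) \<Longrightarrow> c ^ j \<le> Q (\<Prod>i<j. [:- w i, 1:])"
  by (simp add: large_on_def)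

lemma large_on_mult:
  assumes "0 \<le> c" "large_on c j B"
  shows "large_on c (k * j) B"
  unfolding large_on_def
proof (intro allI impI)
  fix w assume w: "\<forall>i<k * j. w i \<in> B"
  have "c ^ (k * j) = (\<Prod>g<k. c ^ j)"
    by (simp add: power_mult mult.commute)
  also have "\<dots> \<le> (\<Prod>g<k. Q (\<Prod>i<j. [:- w (i + g * j), 1:]))"
  proof (rule prod_mono, rule conjI)
    fix g assume "g \<in> {..<k}"
    then have "w (i + g * j) \<in> B" if "i < j" for i
      using that w block_index_less[of g k i j] by blast
    then show "c ^ j \<le> Q (\<Prod>i<j. [:- w (i + g * j), 1:])"
      by (rule large_onD[OF assms(2)])
  qed (use assms in simp)
  also have "\<dots> \<le> Q (\<Prod>i<k * j. [:- w i, 1:])"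
    by (rule Q_blocks)
  finally show "c ^ (k * j) \<le> Q (\<Prod>i<k * j. [:- w i, 1:])" .
qed

lemma large_on_subset: "large_on c j B \<Longrightarrow> A \<subseteq> B \<Longrightarrow> large_on c j A"
  unfolding large_on_def by blast

text \<open>The exponent may be chosen uniformly on a compact set: take a finite subcover and the product of
its exponents, since a bound for exponent \<open>j\<close> passes to all multiples of \<open>j\<close>.\<close>

lemma compact_large_on:
  assumes "compact C" "C \<subseteq> exceeds c" "0 \<le> c"
  shows "\<exists>J\<ge>1. \<exists>r>0. \<forall>\<nu>\<in>C. large_on c J (ball \<nu> r)"
proof -
  have "\<forall>\<nu>\<in>C. \<exists>j r. j \<ge> 1 \<and> r > 0 \<and> large_on c j (ball \<nu> r)"
  proof
    fix \<nu> assume "\<nu> \<in> C"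
    then have "\<nu> \<in> exceeds c" using assms by blast
    then show "\<exists>j r. j \<ge> 1 \<and> r > 0 \<and> large_on c j (ball \<nu> r)"
      unfolding large_on_def by (rule exceedsE) (blast intro: less_imp_le)
  qed
  then obtain j r where jr: "\<And>\<nu>. \<nu> \<in> C \<Longrightarrow> (j \<nu> :: nat) \<ge> 1 \<and> r \<nu> > 0 \<and> large_on c (j \<nu>) (ball \<nu> (r \<nu>))"
    by metis
  obtain F where F: "F \<subseteq> C" "finite F" "C \<subseteq> (\<Union>\<nu>\<in>F. ball \<nu> (r \<nu> / 2))"
    by (rule compactE_image[OF assms(1), of C "\<lambda>\<nu>. ball \<nu> (r \<nu> / 2)"]) (use jr in auto)
  define J where "J = (\<Prod>\<nu>\<in>F. j \<nu>)"
  define R where "R = Min (insert 1 ((\<lambda>\<nu>. r \<nu> / 2) ` F))"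
  have "J \<ge> 1" using F jr unfolding J_def by (intro prod_ge_1) auto
  moreover have "R > 0" using F jr by (auto simp: R_def)
  moreover have "large_on c J (ball \<nu> R)" if "\<nu> \<in> C" for \<nu>
  proof -
    obtain \<mu> where \<mu>: "\<mu> \<in> F" "\<nu> \<in> ball \<mu> (r \<mu> / 2)" using F(3) \<open>\<nu> \<in> C\<close> by blast
    have "R \<le> r \<mu> / 2" unfolding R_def using F(2) \<mu>(1) by (intro Min_le) auto
    then have sub: "ball \<nu> R \<subseteq> ball \<mu> (r \<mu>)"
      using \<mu>(2) by (intro ball_subset_ball_iff[THEN iffD2] disjI1) (simp add: dist_commute)
    have "j \<mu> dvd J" using F \<mu> by (auto simp: J_def)
    then obtain k where "J = k * j \<mu>" by (metis dvd_def mult.commute)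
    then show ?thesis
      using large_on_subset[OF large_on_mult[OF assms(3)] sub] jr[of \<mu>] F(1) \<mu>(1) by blast
  qed
  ultimately show ?thesis by blast
qed

lemma exceeds_raise_point:
  assumes "\<nu> \<in> exceeds m"
  shows "\<exists>c>m. \<nu> \<in> exceeds c"
proof -
  obtain j where j: "j \<ge> 1" "m ^ j < Q ([:- \<nu>, 1:] ^ j)"
    using assms by (auto simp: exceeds_def)
  have "((\<lambda>c. c ^ j) \<longlongrightarrow> m ^ j) (at_right m)"
    by (intro tendsto_intros)
  then have "\<forall>\<^sub>F c in at_right m. c ^ j < Q ([:- \<nu>, 1:] ^ j)"
    using j(2) by (rule order_tendstoD)
  moreover have "\<forall>\<^sub>F c in at_right m. m < c"
    by (rule eventually_at_right_less)
  ultimately have "\<forall>\<^sub>F c in at_right m. m < c \<and> \<nu> \<in> exceeds c"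
    by eventually_elim (use j in \<open>auto simp: exceeds_def\<close>)
  then show ?thesis
    using eventually_happens'[OF trivial_limit_at_right_real] by blast
qed

lemma exceedsI: "c < Q [:- \<nu>, 1:] \<Longrightarrow> \<nu> \<in> exceeds c"
  unfolding exceeds_def by (rule CollectI, rule exI[of _ 1]) simp

lemma exceeds_far: "N [:0, 1:] + c < cmod \<nu> \<Longrightarrow> \<nu> \<in> exceeds c"
  using Q_linear_ge[of \<nu>] by (intro exceedsI) simp

text \<open>A lower bound valid at every point of the plane can be improved: strictness leaves room on a
large disc by compactness, and outside the disc \<open>Q (X - \<nu>)\<close> is large anyway. With \<open>m = 0\<close> this
gives a positive lower bound; with \<open>m\<close> the supremum of all such bounds it shows that the supremum
is attained as a minimum value.\<close>

lemma exceeds_raise: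
  assumes "0 \<le> m" "exceeds m = UNIV"
  shows "\<exists>c>m. exceeds c = UNIV"
proof -
  have "\<forall>\<nu>. \<exists>c>m. \<nu> \<in> exceeds c"
    using exceeds_raise_point[of _ m] assms(2) by blast
  then obtain c where c: "\<And>\<nu>. c \<nu> > m" "\<And>\<nu>. \<nu> \<in> exceeds (c \<nu>)"
    by metis
  let ?C = "cball 0 (N [:0, 1:] + m + 1) :: complex set"
  obtain F where F: "F \<subseteq> ?C" "finite F" "?C \<subseteq> (\<Union>\<nu>\<in>F. exceeds (c \<nu>))"
    by (rule compactE_image[of ?C ?C "\<lambda>\<nu>. exceeds (c \<nu>)"]) (use c open_exceeds in auto)
  define d where "d = Min (insert (m + 1) (c ` F))"
  have "d > m" using F(2) c by (auto simp: d_def)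
  moreover have "\<nu> \<in> exceeds d" for \<nu>
  proof (cases "\<nu> \<in> ?C")
    case True
    then obtain \<mu> where \<mu>: "\<mu> \<in> F" "\<nu> \<in> exceeds (c \<mu>)" using F(3) by blast
    have "d \<le> c \<mu>" unfolding d_def using F(2) \<mu>(1) by (intro Min_le) auto
    then show ?thesis using exceeds_antimono[of d "c \<mu>"] \<mu>(2) \<open>d > m\<close> assms(1) by auto
  next
    case False
    have "d \<le> m + 1" unfolding d_def using F(2) by (intro Min_le) auto
    then show ?thesis using False by (intro exceeds_far) auto
  qed
  ultimately show ?thesis by blast
qed

lemma dist_circle_points: "dist (l + of_real m * cis a) (l + of_real m * cis b) \<le> \<bar>m\<bar> * \<bar>a - b\<bar>"
proof -
  have "cis a - cis b = cis b * (exp (\<i> * of_real (a - b)) - 1)"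
    by (simp add: cis_conv_exp exp_add[symmetric] algebra_simps)
  then have "cmod (cis a - cis b) = 2 * \<bar>sin ((a - b) / 2)\<bar>"
    by (simp only: norm_mult norm_cis dist_exp_i_1)
  also have "\<dots> \<le> \<bar>a - b\<bar>"
    using abs_sin_x_le_abs_x[of "(a - b) / 2"] by simp
  finally have "\<bar>m\<bar> * cmod (cis a - cis b) \<le> \<bar>m\<bar> * \<bar>a - b\<bar>"
    by (rule mult_left_mono) simp
  then show ?thesis
    by (simp add: dist_norm right_diff_distrib[symmetric] norm_mult)
qed

text \<open>The minimum principle. The grouped lower bound contains more than \<open>m\<close> per factor on one arc
out of \<open>k0\<close> and slightly less than \<open>m\<close> on the others; the loss \<open>m - c\<close> is chosen after the length of
the arc so that the gain wins.\<close>

theorem exists_zero: "\<exists>\<nu>. Q [:- \<nu>, 1:] = 0"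
proof (rule ccontr)
  assume "\<not> ?thesis"
  then have "Q [:- \<nu>, 1:] \<noteq> 0" for \<nu>
    by blast
  then have pos: "Q [:- \<nu>, 1:] > 0" for \<nu>
    using Q_nonneg by (rule order.not_eq_order_implies_strict[OF not_sym])
  define S where "S = {c. 0 \<le> c \<and> exceeds c = UNIV}"
  have S0: "0 \<in> S"
    using pos exceedsI by (auto simp: S_def)
  have S_le: "c \<le> N [:0, 1:]" if "c \<in> S" for c
  proof -
    have "0 \<in> exceeds c" using that by (simp add: S_def)
    then obtain j where "c ^ j < Q ([:0, 1:] ^ j)"
      by (auto simp: exceeds_def)
    also have "\<dots> \<le> N [:0, 1:] ^ j"
      using Q_le_N N_power order_trans by blast
    finally show ?thesis
      using power_less_imp_less_base[OF _ N_nonneg] by fastforce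
  qed
  then have bdd: "bdd_above S" by (meson bdd_above.I)
  \<comment> \<open>the minimum of \<open>sup\<^sub>j Q((X - \<nu>)\<^sup>j)\<^bsup>1/j\<^esup>\<close> over all \<open>\<nu>\<close>\<close>
  define m where "m = Sup S"
  have below: "exceeds c = UNIV" if c: "0 \<le> c" "c < m" for c
  proof -
    obtain c' where "c' \<in> S" "c < c'"
      using c(2) less_cSup_iff[OF _ bdd, of c] S0 unfolding m_def by blast
    then show ?thesis using exceeds_antimono[of c c'] c by (auto simp: S_def)
  qed
  obtain c1 where "c1 > 0" "exceeds c1 = UNIV"
    using exceeds_raise[of 0] S0 by (auto simp: S_def)
  then have m: "m > 0"
    using cSup_upper[OF _ bdd, of c1] by (simp add: S_def m_def)
  have ne: "exceeds m \<noteq> UNIV"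
  proof
    assume "exceeds m = UNIV"
    then obtain c where "c > m" "exceeds c = UNIV"
      using exceeds_raise m by (meson less_imp_le)
    then show False
      using cSup_upper[OF _ bdd, of c] m by (simp add: S_def m_def)
  qed
  \<comment> \<open>\<open>- exceeds m\<close> is the set of minimum points\<close>
  have "bounded (- exceeds m)"
    by (rule boundedI[of _ "N [:0, 1:] + m"]) (use exceeds_far in force)
  then have "compact (- exceeds m)"
    using open_exceeds by (simp add: compact_eq_bounded_closed closed_def)
  moreover have "- exceeds m \<noteq> {}"
    using ne by blast
  ultimately have "\<exists>l\<in>- exceeds m. \<forall>\<nu>\<in>- exceeds m. Re \<nu> \<le> Re l"
    by (rule continuous_attains_sup) (intro continuous_intros)
  then obtain l where l: "l \<notin> exceeds m" "\<And>\<nu>. \<nu> \<notin> exceeds m \<Longrightarrow> Re \<nu> \<le> Re l"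
    by blast
  have Q_l: "Q ([:- l, 1:] ^ n) \<le> m ^ n" if "n \<ge> 1" for n
    using l(1) that by (auto simp: exceeds_def not_less)
  define \<mu> where "\<mu> = l + of_real m"
  have "\<mu> \<in> exceeds m" using l(2)[of \<mu>] m by (auto simp: \<mu>_def)
  then obtain d where d: "d > m" "\<mu> \<in> exceeds d" using exceeds_raise_point by blast
  then obtain j0 r0 where j0: "j0 \<ge> 1" "r0 > 0" "large_on d j0 (ball \<mu> r0)"
    unfolding large_on_def by (elim exceedsE) (blast intro: less_imp_le)
  \<comment> \<open>an arc of \<open>1/k0\<close> of the circle, starting at \<open>\<mu>\<close>, stays in \<open>ball \<mu> r0\<close>\<close>
  obtain k0 :: nat where k0: "2 * pi * m / r0 < real k0"
    using reals_Archimedean2 by blast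
  then have k0_pos: "k0 > 0"
  proof -
    have "0 < 2 * pi * m / r0" using m j0(2) by simp
    then show ?thesis using k0 by linarith
  qed
  obtain c where c: "0 < c" "c < m" "m ^ k0 < d * c ^ (k0 - 1)"
  proof -
    have "((\<lambda>c. d * c ^ (k0 - 1)) \<longlongrightarrow> d * m ^ (k0 - 1)) (at_left m)"
      by (intro tendsto_intros)
    moreover have "m ^ k0 < d * m ^ (k0 - 1)"
      using d(1) m k0_pos by (cases k0) auto
    ultimately have "\<forall>\<^sub>F c in at_left m. m ^ k0 < d * c ^ (k0 - 1)"
      by (rule order_tendstoD)
    moreover have "\<forall>\<^sub>F c in at_left m. c \<in> {0<..<m}"
      using m by (rule eventually_at_left_real)
    ultimately have "\<forall>\<^sub>F c in at_left m. m ^ k0 < d * c ^ (k0 - 1) \<and> c \<in> {0<..<m}"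
      by (rule eventually_conj)
    from eventually_happens'[OF trivial_limit_at_left_real this] show ?thesis
      using that by auto
  qed
  obtain J1 r where J1: "J1 \<ge> 1" "r > 0" "\<And>\<nu>. \<nu> \<in> sphere l m \<Longrightarrow> large_on c J1 (ball \<nu> r)"
    using compact_large_on[of "sphere l m" c, OF compact_sphere] below[of c] c
    by (metis less_imp_le subset_UNIV)
  define J where "J = J1 * j0"
  have J: "J \<ge> 1" using J1 j0 by (simp add: J_def)
  have arc: "large_on d J (ball \<mu> r0)"
    unfolding J_def using d m j0 by (intro large_on_mult) auto
  have circ: "large_on c J (ball \<nu> r)" if "\<nu> \<in> sphere l m" for \<nu>
    unfolding J_def using large_on_mult[OF _ J1(3)[OF that], of j0] c by (simp add: mult.commute)
  define \<rho> where "\<rho> = d * c ^ (k0 - 1) / m ^ k0"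
  have \<rho>: "\<rho> > 1" using c m by (simp add: \<rho>_def)
  \<comment> \<open>\<open>K1\<close> makes the gain exceed \<open>2\<close>; \<open>K2\<close> makes each block of \<open>J\<close> roots shorter than \<open>r\<close>\<close>
  obtain K1 where K1: "2 < \<rho> ^ K1" using real_arch_pow[OF \<rho>] by blast
  obtain K2 :: nat where K2: "2 * pi * m / r < real K2" using reals_Archimedean2 by blast
  define L where "L = max 1 (max K1 K2)"
  have L: "L \<ge> 1" "K1 \<le> L" "K2 \<le> L" by (auto simp: L_def)
  \<comment> \<open>\<open>K\<close> blocks of \<open>J\<close> roots, of which exactly the first \<open>L\<close> lie on the good arc\<close>
  define K where "K = k0 * L"
  have K_pos: "K > 0" using k0_pos L by (simp add: K_def)
  have LK: "L \<le> K" using k0_pos by (simp add: K_def)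
  define n where "n = K * J"
  have n: "n \<ge> 1" using K_pos J by (simp add: n_def Suc_leI)
  define w where "w i = l + of_real m * cis (2 * pi * real i / real n)" for i :: nat
  have w_sphere: "w i \<in> sphere l m" for i
    using m by (simp add: w_def dist_norm norm_mult)
  have dist_w: "dist (w i) (w i') \<le> m * (2 * pi * (real i' - real i) / real n)" if "i \<le> i'" for i i'
  proof -
    have "dist (w i) (w i') \<le> \<bar>m\<bar> * \<bar>2 * pi * real i / real n - 2 * pi * real i' / real n\<bar>"
      unfolding w_def by (rule dist_circle_points)
    also have "\<bar>2 * pi * real i / real n - 2 * pi * real i' / real n\<bar> = 2 * pi * (real i' - real i) / real n"
      using that by (simp add: diff_divide_distrib[symmetric] right_diff_distrib[symmetric] abs_mult)
    finally show ?thesis using m by simp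
  qed
  have block_c: "c ^ J \<le> Q (\<Prod>i<J. [:- w (i + g * J), 1:])" for g
  proof -
    have "w (i + g * J) \<in> ball (w (g * J)) r" if "i < J" for i
    proof -
      have "dist (w (g * J)) (w (i + g * J)) \<le> m * (2 * pi * real i / real n)"
        using dist_w[of "g * J" "i + g * J"] by simp
      also have "\<dots> \<le> m * (2 * pi * real J / real n)"
        using that m by (intro mult_left_mono divide_right_mono) auto
      also have "\<dots> = 2 * pi * m / real K"
        using J by (simp add: n_def field_simps)
      also have "\<dots> < r"
      proof -
        have "K2 \<le> K" using L LK by simp
        then have "2 * pi * m / r < real K" using K2 by linarith
        then show ?thesis using J1(2) K_pos by (simp add: field_simps)
      qed
      finally show ?thesis by simp
    qed
    then show ?thesis
      by (rule large_onD[OF circ[OF w_sphere]])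
  qed
  have block_d: "d ^ J \<le> Q (\<Prod>i<J. [:- w (i + g * J), 1:])" if "g < L" for g
  proof -
    have "w (i + g * J) \<in> ball \<mu> r0" if "i < J" for i
    proof -
      have "i + g * J \<le> L * J" using block_index_less[OF \<open>g < L\<close> that] by simp
      have "dist (w 0) (w (i + g * J)) \<le> m * (2 * pi * real (i + g * J) / real n)"
        using dist_w[of 0 "i + g * J"] by simp
      also have "\<dots> \<le> m * (2 * pi * real (L * J) / real n)"
        using \<open>i + g * J \<le> L * J\<close> m
        by (intro mult_left_mono divide_right_mono) (auto simp del: of_nat_add of_nat_mult)
      also have "\<dots> = 2 * pi * m / real k0"
        using J L by (simp add: n_def K_def field_simps)
      also have "\<dots> < r0"
        using k0 k0_pos j0(2) by (simp add: field_simps)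
      finally show ?thesis by (simp add: \<mu>_def w_def)
    qed
    then show ?thesis
      by (rule large_onD[OF arc])
  qed
  have "(d * c ^ (k0 - 1)) ^ (L * J) = (\<Prod>g<K. if g < L then d ^ J else c ^ J)"
  proof -
    have "{..<K} \<inter> {g. g < L} = {..<L}" "{..<K} \<inter> - {g. g < L} = {L..<K}"
      using LK by auto
    then have "(\<Prod>g<K. if g < L then d ^ J else c ^ J) = (d ^ J) ^ L * (c ^ J) ^ (K - L)"
      by (simp add: prod.If_cases)
    also have "K - L = (k0 - 1) * L"
      by (simp add: K_def diff_mult_distrib)
    also have "(d ^ J) ^ L * (c ^ J) ^ ((k0 - 1) * L) = (d * c ^ (k0 - 1)) ^ (L * J)"
      by (simp add: power_mult_distrib power_mult[symmetric] mult_ac)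
    finally show ?thesis ..
  qed
  also have "\<dots> \<le> (\<Prod>g<K. Q (\<Prod>i<J. [:- w (i + g * J), 1:]))"
    using block_c block_d c d m by (intro prod_mono) auto
  also have "\<dots> \<le> Q (\<Prod>i<n. [:- w i, 1:])"
    unfolding n_def by (rule Q_blocks)
  also have "(\<Prod>i<n. [:- w i, 1:]) = [:- l, 1:] ^ n - [:of_real m ^ n:]"
    unfolding w_def using n by (intro power_diff_eq_prod_linear[symmetric]) auto
  also have "Q ([:- l, 1:] ^ n - [:of_real m ^ n:]) \<le> Q ([:- l, 1:] ^ n) + N [:- (of_real m ^ n):]"
    using Q_diff[of "[:- l, 1:] ^ n - [:of_real m ^ n:]" "[:- l, 1:] ^ n"] by simp
  also have "\<dots> \<le> m ^ n + m ^ n"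
    using Q_l[OF n] N_const[of "- (of_real m ^ n)"] m by (intro add_mono) (auto simp: norm_power)
  also have "\<dots> = 2 * (m ^ k0) ^ (L * J)"
    by (simp add: n_def K_def power_mult[symmetric] mult_ac)
  finally have "\<rho> ^ (L * J) \<le> 2"
    using m by (simp add: \<rho>_def power_divide divide_le_eq)
  moreover have "\<rho> ^ K1 \<le> \<rho> ^ (L * J)"
    using \<rho> L J by (intro power_increasing) (auto intro: order_trans[of _ L])
  ultimately show False using K1 by simp
qed

end


section \<open>The measure of noncompactness and the lower modulus of an operator\<close>

definition finitely_covered :: "real \<Rightarrow> 'a::metric_space set \<Rightarrow> bool" where
  "finitely_covered r M \<longleftrightarrow> (\<exists>C. finite C \<and> M \<subseteq> (\<Union>c\<in>C. cball c r))"

text \<open>The Hausdorff measure of noncompactness; it is meaningful for bounded sets only.\<close>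

definition noncompactness :: "'a::metric_space set \<Rightarrow> real" where
  "noncompactness M = Inf {r. 0 \<le> r \<and> finitely_covered r M}"

lemma finitely_covered_mono: "finitely_covered r M \<Longrightarrow> r \<le> s \<Longrightarrow> finitely_covered s M"
  unfolding finitely_covered_def by (meson SUP_mono subset_cball subset_trans)

lemma bounded_imp_finitely_covered:
  assumes "bounded M"
  obtains r where "0 \<le> r" "finitely_covered r M"
proof -
  obtain c r where "M \<subseteq> cball c r" using assms bounded_subset_cball by blast
  then have "M \<subseteq> cball c (max 0 r)" by (meson max.cobounded2 subset_cball subset_trans)
  then show ?thesis
    by (intro that[of "max 0 r"]) (auto simp: finitely_covered_def intro!: exI[of _ "{c}"])
qed

lemma noncompactness_nonneg: "bounded M \<Longrightarrow> 0 \<le> noncompactness M"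
  unfolding noncompactness_def
  by (rule cInf_greatest) (use bounded_imp_finitely_covered in auto)

lemma noncompactness_le: "0 \<le> r \<Longrightarrow> finitely_covered r M \<Longrightarrow> noncompactness M \<le> r"
  unfolding noncompactness_def by (rule cInf_lower) (auto intro: bdd_belowI)

lemma finitely_covered_gt:
  assumes "bounded M" "noncompactness M < r"
  shows "finitely_covered r M"
proof -
  have "{r. 0 \<le> r \<and> finitely_covered r M} \<noteq> {}"
    using assms(1) bounded_imp_finitely_covered by blast
  from cInf_lessD[OF this assms(2)[unfolded noncompactness_def]]
  obtain s where "finitely_covered s M" "s < r"
    by blast
  then show ?thesis using finitely_covered_mono[of s M r] by simp
qed

lemma noncompactness_image_le:
  assumes "bounded M" "0 \<le> K" "\<And>x y. dist (f x) (f y) \<le> K * dist x y"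
  shows "noncompactness (f ` M) \<le> K * noncompactness M"
proof (rule field_le_epsilon)
  fix e :: real assume "e > 0"
  define r where "r = noncompactness M + e / (K + 1)"
  have "noncompactness M < r" using \<open>e > 0\<close> assms(2) by (simp add: r_def)
  then have "finitely_covered r M" by (rule finitely_covered_gt[OF assms(1)])
  then obtain C where C: "finite C" "M \<subseteq> (\<Union>c\<in>C. cball c r)"
    unfolding finitely_covered_def by blast
  have "f ` M \<subseteq> (\<Union>c\<in>f ` C. cball c (K * r))"
  proof
    fix y assume "y \<in> f ` M"
    then obtain x c where xc: "y = f x" "c \<in> C" "dist c x \<le> r" using C by auto
    then have "dist (f c) y \<le> K * r"
      using assms(3)[of c x] mult_left_mono[OF xc(3) assms(2)] by simp
    then show "y \<in> (\<Union>c\<in>f ` C. cball c (K * r))" using xc by auto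
  qed
  then have "finitely_covered (K * r) (f ` M)"
    unfolding finitely_covered_def using C(1) by blast
  moreover have "0 \<le> r"
    using noncompactness_nonneg[OF assms(1)] \<open>e > 0\<close> assms(2) by (simp add: r_def)
  ultimately have "noncompactness (f ` M) \<le> K * r"
    using assms(2) by (intro noncompactness_le) auto
  also have "\<dots> \<le> K * noncompactness M + e"
    using \<open>e > 0\<close> assms(2) by (simp add: r_def distrib_left field_simps)
  finally show "noncompactness (f ` M) \<le> K * noncompactness M + e" .
qed

lemma noncompactness_add_le:
  fixes g h :: "'a \<Rightarrow> 'b::real_normed_vector"
  assumes "bounded (g ` M)" "bounded (h ` M)"
  shows "noncompactness ((\<lambda>x. g x + h x) ` M) \<le> noncompactness (g ` M) + noncompactness (h ` M)"
proof (rule field_le_epsilon)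
  fix e :: real assume "e > 0"
  define r s where "r = noncompactness (g ` M) + e / 2" and "s = noncompactness (h ` M) + e / 2"
  have "finitely_covered r (g ` M)" "finitely_covered s (h ` M)"
    using assms \<open>e > 0\<close> by (auto simp: r_def s_def intro!: finitely_covered_gt)
  then obtain C D where C: "finite C" "g ` M \<subseteq> (\<Union>c\<in>C. cball c r)"
    and D: "finite D" "h ` M \<subseteq> (\<Union>d\<in>D. cball d s)"
    unfolding finitely_covered_def by blast
  have "(\<lambda>x. g x + h x) ` M \<subseteq> (\<Union>c\<in>(\<lambda>(c, d). c + d) ` (C \<times> D). cball c (r + s))"
  proof
    fix y assume "y \<in> (\<lambda>x. g x + h x) ` M"
    then obtain x where x: "x \<in> M" "y = g x + h x" by blast
    obtain c where c: "c \<in> C" "dist c (g x) \<le> r" using C x(1) by fastforce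
    obtain d where d: "d \<in> D" "dist d (h x) \<le> s" using D x(1) by fastforce
    have "dist (c + d) y \<le> r + s"
      using c d dist_triangle_add[of c d "g x" "h x"] by (simp add: x)
    then show "y \<in> (\<Union>c\<in>(\<lambda>(c, d). c + d) ` (C \<times> D). cball c (r + s))" using c d by auto
  qed
  then have "finitely_covered (r + s) ((\<lambda>x. g x + h x) ` M)"
    unfolding finitely_covered_def using C(1) D(1)
    by (intro exI[of _ "(\<lambda>(c, d). c + d) ` (C \<times> D)"]) simp
  moreover have "0 \<le> r + s"
    using noncompactness_nonneg assms \<open>e > 0\<close> by (auto simp: r_def s_def intro!: add_nonneg_nonneg)
  ultimately have "noncompactness ((\<lambda>x. g x + h x) ` M) \<le> r + s"
    by (intro noncompactness_le)
  then show "noncompactness ((\<lambda>x. g x + h x) ` M) \<le> noncompactness (g ` M) + noncompactness (h ` M) + e"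
    by (simp add: r_def s_def)
qed

lemma noncompactness_linear_image_le:
  assumes "bounded_linear S" "bounded M"
  shows "noncompactness (S ` M) \<le> onorm S * noncompactness M"
proof (rule noncompactness_image_le[OF assms(2) onorm_pos_le[OF assms(1)]])
  fix x y
  show "dist (S x) (S y) \<le> onorm S * dist x y"
    using onorm[OF assms(1), of "x - y"] by (simp add: dist_norm bounded_linear.linear[OF assms(1)] linear_diff)
qed

lemma noncompactness_scaleR:
  fixes M :: "'a::real_normed_vector set"
  assumes "bounded M" "0 < r"
  shows "noncompactness ((*\<^sub>R) r ` M) = r * noncompactness M"
proof (rule antisym)
  show "noncompactness ((*\<^sub>R) r ` M) \<le> r * noncompactness M"
    using assms by (intro noncompactness_image_le) (auto simp: dist_norm scaleR_diff_right[symmetric])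
  have "noncompactness ((*\<^sub>R) (inverse r) ` (*\<^sub>R) r ` M) \<le> inverse r * noncompactness ((*\<^sub>R) r ` M)"
    using assms by (intro noncompactness_image_le bounded_scaling) (auto simp: dist_norm scaleR_diff_right[symmetric])
  then have "noncompactness M \<le> inverse r * noncompactness ((*\<^sub>R) r ` M)"
    using assms(2) by (simp add: image_image)
  then show "r * noncompactness M \<le> noncompactness ((*\<^sub>R) r ` M)"
    using assms(2) by (simp add: field_simps)
qed

text \<open>Normalising by \<open>noncompactness M = 1\<close> avoids dividing by \<open>0\<close> on totally bounded sets. The set is
nonempty exactly when some bounded set is not totally bounded, that is, in infinite dimension.\<close>

definition lower_modulus :: "('a::real_normed_vector \<Rightarrow> 'b::real_normed_vector) \<Rightarrow> real" where
  "lower_modulus S = Inf {noncompactness (S ` M) | M. bounded M \<and> noncompactness M = 1}"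

lemma lower_modulus_le:
  assumes "bounded_linear S" "bounded M"
  shows "lower_modulus S * noncompactness M \<le> noncompactness (S ` M)"
proof (cases "noncompactness M = 0")
  case True
  then show ?thesis
    using noncompactness_nonneg bounded_linear_image[OF assms(2,1)] by simp
next
  case False
  define r where "r = inverse (noncompactness M)"
  have r: "r > 0" using False noncompactness_nonneg[OF assms(2)] by (simp add: r_def)
  have "lower_modulus S \<le> noncompactness (S ` (*\<^sub>R) r ` M)"
    unfolding lower_modulus_def
  proof (rule cInf_lower)
    show "noncompactness (S ` (*\<^sub>R) r ` M) \<in> {noncompactness (S ` M) | M. bounded M \<and> noncompactness M = 1}"
    proof (intro CollectI exI[of _ "(*\<^sub>R) r ` M"] conjI refl)
      show "bounded ((*\<^sub>R) r ` M)" by (rule bounded_scaling[OF assms(2)])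
      show "noncompactness ((*\<^sub>R) r ` M) = 1"
        unfolding noncompactness_scaleR[OF assms(2) r] using False by (simp add: r_def)
    qed
    show "bdd_below {noncompactness (S ` M) | M. bounded M \<and> noncompactness M = 1}"
      by (rule bdd_belowI[of _ 0]) (auto intro!: noncompactness_nonneg bounded_linear_image assms)
  qed
  also have "S ` (*\<^sub>R) r ` M = (*\<^sub>R) r ` S ` M"
    using bounded_linear.linear[OF assms(1)] by (auto simp: image_image linear_scale)
  also have "noncompactness \<dots> = r * noncompactness (S ` M)"
    by (rule noncompactness_scaleR[OF bounded_linear_image[OF assms(2,1)] r])
  finally show ?thesis using r by (simp add: r_def field_simps)
qed

lemma bounded_linear_scaleC_left: "bounded_linear (\<lambda>c. c *\<^sub>C (v::'a::complex_normed_vector))"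
proof (rule bounded_linear_intro)
  show "(r *\<^sub>R c) *\<^sub>C v = r *\<^sub>R (c *\<^sub>C v)" for r c
    by (simp add: scaleR_conv_of_real scaleC_of_real[symmetric] scaleC_scaleC)
  show "norm (c *\<^sub>C v) \<le> norm c * norm v" for c
    by (simp add: norm_scaleC)
qed (rule scaleC_add_left)

lemma bounded_linear_scaleC_right: "bounded_linear (\<lambda>v::'a::complex_normed_vector. c *\<^sub>C v)"
proof (rule bounded_linear_intro)
  show "c *\<^sub>C (r *\<^sub>R v) = r *\<^sub>R (c *\<^sub>C v)" for r and v :: 'a
    by (simp add: scaleC_of_real[symmetric] scaleC_scaleC mult.commute)
  show "norm (c *\<^sub>C v) \<le> norm v * cmod c" for v :: 'a
    by (simp add: norm_scaleC)
qed (rule scaleC_add_right)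

text \<open>Horner evaluation of a polynomial at an operator.\<close>

definition poly_apply :: "('a::complex_normed_vector \<Rightarrow> 'a) \<Rightarrow> complex poly \<Rightarrow> 'a \<Rightarrow> 'a" where
  "poly_apply T p = fold_coeffs (\<lambda>a S x. a *\<^sub>C x + T (S x)) p (\<lambda>_. 0)"

context
  fixes T :: "'a::complex_normed_vector \<Rightarrow> 'a"
  assumes T: "bounded_clinear T"
begin

lemma clinear_bounded_linear: "bounded_linear T" and clinear_scaleC: "T (a *\<^sub>C x) = a *\<^sub>C T x"
  using T by (auto simp: bounded_clinear_def)

lemma clinear_0: "T 0 = 0" and clinear_add: "T (x + y) = T x + T y"
  using bounded_linear.linear[OF clinear_bounded_linear] by (auto simp: linear_0 linear_add)

lemma poly_apply_0 [simp]: "poly_apply T 0 x = 0"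
  by (simp add: poly_apply_def)

lemma poly_apply_pCons [simp]: "poly_apply T (pCons a p) x = a *\<^sub>C x + T (poly_apply T p x)"
  by (cases "p = 0 \<and> a = 0") (auto simp: poly_apply_def clinear_0)

lemma poly_apply_linear: "bounded_linear (poly_apply T p)"
proof (induction p)
  case 0
  then show ?case using bounded_linear_zero by (simp add: poly_apply_def)
next
  case (pCons a p)
  have "bounded_linear (\<lambda>x. a *\<^sub>C x + T (poly_apply T p x))"
    by (intro bounded_linear_add bounded_linear_scaleC_right bounded_linear_compose[OF clinear_bounded_linear] pCons)
  moreover have "poly_apply T (pCons a p) = (\<lambda>x. a *\<^sub>C x + T (poly_apply T p x))"
    by (simp add: fun_eq_iff)
  ultimately show ?case by simp
qed

lemma poly_apply_add: "poly_apply T (p + q) x = poly_apply T p x + poly_apply T q x"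
  by (induction p q rule: poly_induct2) (simp_all add: scaleC_add_left clinear_add algebra_simps)

lemma poly_apply_smult: "poly_apply T (smult c p) x = c *\<^sub>C poly_apply T p x"
  by (induction p) (simp_all add: scaleC_add_right clinear_scaleC scaleC_scaleC)

lemma poly_apply_mult: "poly_apply T (p * q) x = poly_apply T p (poly_apply T q x)"
  by (induction p) (simp_all add: poly_apply_add poly_apply_smult)

end

text \<open>The distance \<open>d\<close> of \<open>v\<close> from the closed subspace bounds the coefficient of \<open>v\<close>, so the
coefficients of a convergent sequence form a Cauchy sequence.\<close>

lemma closed_cspan_insert:
  fixes v :: "'a::complex_normed_vector"
  assumes closed: "closed (cspan B)"
  shows "closed (cspan (insert v B))"
proof (cases "v \<in> cspan B")
  case True
  then show ?thesis using closed by (simp add: complex_vector.span_redundant)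
next
  case False
  let ?E = "cspan B"
  define d where "d = infdist v ?E"
  have E: "csubspace ?E" by (rule complex_vector.subspace_span)
  have "?E \<noteq> {}" using complex_vector.span_zero[of B] by blast
  then have d: "d > 0"
    using False closed in_closed_iff_infdist_zero[of ?E v] infdist_nonneg[of v ?E] by (simp add: d_def)
  have coeff: "cmod k * d \<le> norm u" if "u - k *\<^sub>C v \<in> ?E" for u k
  proof (cases "k = 0")
    case False
    have "(- inverse k) *\<^sub>C (u - k *\<^sub>C v) \<in> ?E" using that complex_vector.subspace_scale[OF E] by blast
    moreover have "(- inverse k) *\<^sub>C (u - k *\<^sub>C v) = v - inverse k *\<^sub>C u"
      using False by (simp add: complex_vector.scale_right_diff_distrib scaleC_scaleC scaleC_of_real[of 1, simplified])
    ultimately have "d \<le> dist v (v - inverse k *\<^sub>C u)" unfolding d_def by (metis infdist_le)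
    also have "\<dots> = inverse (cmod k) * norm u" by (simp add: dist_norm norm_scaleC norm_inverse)
    finally show ?thesis using False by (simp add: field_simps)
  qed simp
  show ?thesis
    unfolding closed_sequential_limits
  proof (intro allI impI, elim conjE)
    fix u l assume u: "\<forall>n. u n \<in> cspan (insert v B)" "u \<longlonglongrightarrow> l"
    then have "\<forall>n. \<exists>k. u n - k *\<^sub>C v \<in> ?E"
      unfolding complex_vector.span_insert by blast
    then obtain k where k: "\<And>n. u n - k n *\<^sub>C v \<in> ?E"
      by metis
    have "Cauchy k"
    proof (rule metric_CauchyI)
      fix e :: real assume "e > 0"
      then obtain M where M: "\<And>m n. m \<ge> M \<Longrightarrow> n \<ge> M \<Longrightarrow> dist (u m) (u n) < e * d"
        using LIMSEQ_imp_Cauchy[OF u(2)] d unfolding Cauchy_def by (metis mult_pos_pos)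
      have "dist (k m) (k n) < e" if "m \<ge> M" "n \<ge> M" for m n
      proof -
        have "(u m - k m *\<^sub>C v) - (u n - k n *\<^sub>C v) \<in> ?E"
          using k complex_vector.subspace_diff[OF E] by blast
        then have "(u m - u n) - (k m - k n) *\<^sub>C v \<in> ?E"
          by (simp add: complex_vector.scale_left_diff_distrib algebra_simps)
        then have "cmod (k m - k n) * d \<le> norm (u m - u n)" by (rule coeff)
        also have "\<dots> < e * d" using M[OF that] by (simp add: dist_norm)
        finally show ?thesis using d by (simp add: dist_norm)
      qed
      then show "\<exists>M. \<forall>m\<ge>M. \<forall>n\<ge>M. dist (k m) (k n) < e" by blast
    qed
    then obtain k0 where "k \<longlonglongrightarrow> k0" using Cauchy_convergent convergent_def by blast
    then have "(\<lambda>n. u n - k n *\<^sub>C v) \<longlonglongrightarrow> l - k0 *\<^sub>C v"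
      by (intro tendsto_diff u(2) bounded_linear.tendsto[OF bounded_linear_scaleC_left])
    then have "l - k0 *\<^sub>C v \<in> ?E" by (rule closed_sequentially[OF closed k])
    then show "l \<in> cspan (insert v B)" unfolding complex_vector.span_insert by blast
  qed
qed

lemma closed_cspan_finite: "finite B \<Longrightarrow> closed (cspan B)"
  by (induction B rule: finite_induct) (simp_all add: closed_cspan_insert)

text \<open>A form of the Riesz lemma. Finitely many centres span a closed subspace \<open>E\<close>; if balls of radius
\<open>1/2\<close> about them covered the unit ball, every \<open>x\<close> would satisfy
\<open>dist(x, E) \<le> dist(x, E) / 2\<close> and hence lie in \<open>E\<close>.\<close>

lemma infinite_dimensional_not_covered:
  assumes "infinite_dimensional (UNIV :: 'a::complex_normed_vector set)"
  shows "\<not> finitely_covered (1/2) (cball (0::'a::complex_normed_vector) 1)"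
proof
  assume "finitely_covered (1/2) (cball (0::'a) 1)"
  then obtain C where C: "finite C" "cball (0::'a) 1 \<subseteq> (\<Union>c\<in>C. cball c (1/2))"
    unfolding finitely_covered_def by blast
  let ?E = "cspan C"
  have E: "csubspace ?E" by (rule complex_vector.subspace_span)
  have ne: "?E \<noteq> {}" using complex_vector.span_zero[of C] by blast
  have half: "\<exists>e\<in>?E. norm (x - e) \<le> norm x / 2" for x
  proof (cases "x = 0")
    case True
    then show ?thesis using complex_vector.span_zero[of C] by auto
  next
    case False
    have "sgn x \<in> cball 0 1" using False by (simp add: norm_sgn)
    then obtain c where c: "c \<in> C" "dist c (sgn x) \<le> 1/2" using C(2) by auto
    have "norm x *\<^sub>R c \<in> ?E"
      using complex_vector.subspace_scale[OF E complex_vector.span_base[OF c(1)], of "of_real (norm x)"]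
      by (simp add: scaleC_of_real)
    moreover have "norm (x - norm x *\<^sub>R c) = norm x * dist c (sgn x)"
    proof -
      have "x - norm x *\<^sub>R c = norm x *\<^sub>R (sgn x - c)"
        using False by (simp add: sgn_div_norm scaleR_right_diff_distrib)
      then show ?thesis by (simp add: dist_norm norm_minus_commute)
    qed
    ultimately show ?thesis using c(2) mult_left_mono[OF c(2) norm_ge_zero[of x]] by force
  qed
  have "x \<in> ?E" for x
  proof -
    have "2 * infdist x ?E \<le> dist x e" if e: "e \<in> ?E" for e
    proof -
      obtain e' where e': "e' \<in> ?E" "norm (x - e - e') \<le> norm (x - e) / 2" using half by blast
      have "infdist x ?E \<le> dist x (e + e')"
        by (intro infdist_le complex_vector.subspace_add[OF E] e e')
      then show ?thesis using e'(2) by (simp add: dist_norm algebra_simps)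
    qed
    then have "2 * infdist x ?E \<le> infdist x ?E"
      by (subst (2) infdist_notempty[OF ne]) (intro cINF_greatest[OF ne])
    then have "infdist x ?E = 0" using infdist_nonneg[of x ?E] by simp
    then show ?thesis
      using in_closed_iff_infdist_zero[OF closed_cspan_finite[OF C(1)] ne] by simp
  qed
  then show False using assms C(1) unfolding infinite_dimensional_def by blast
qed

lemma infinite_dimensional_unit_noncompactness:
  assumes "infinite_dimensional (UNIV :: 'a::complex_normed_vector set)"
  obtains M :: "'a::complex_normed_vector set" where "bounded M" "noncompactness M = 1"
proof -
  let ?B = "cball (0::'a) 1" and ?r = "noncompactness (cball (0::'a) 1)"
  have "?r \<ge> 1/2"
    using finitely_covered_gt[of ?B "1/2"] infinite_dimensional_not_covered[OF assms] by force
  then have "noncompactness ((*\<^sub>R) (inverse ?r) ` ?B) = 1"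
    by (subst noncompactness_scaleR) auto
  then show ?thesis using that[OF bounded_scaling] by auto
qed

section \<open>Infinite-dimensional subspaces on which an operator is small\<close>

lemma not_covered_separated_sequence:
  assumes "\<not> finitely_covered r M"
  obtains x :: "nat \<Rightarrow> 'a::metric_space" where "\<And>n. x n \<in> M" "\<And>i j. i < j \<Longrightarrow> r < dist (x i) (x j)"
proof -
  have "\<exists>x :: nat \<Rightarrow> 'a. \<forall>n. x n \<in> M \<and> (\<forall>i<n. r < dist (x i) (x n))"
  proof (rule dependent_wellorder_choice)
    fix n :: nat and x :: "nat \<Rightarrow> 'a"
    have "\<not> M \<subseteq> (\<Union>c\<in>x ` {..<n}. cball c r)"
      using assms unfolding finitely_covered_def by (metis finite_imageI finite_lessThan)
    then show "\<exists>z. z \<in> M \<and> (\<forall>i<n. r < dist (x i) z)" by force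
  qed simp
  then show ?thesis using that by blast
qed

text \<open>A bounded sequence has differences \<open>x i - x j\<close> that are almost orthogonal to a given compact set.
Otherwise each pair \<open>i < j\<close> violates the inequality for some \<open>(e, t)\<close>, which may be taken from a
finite net; by Ramsey's theorem one \<open>(e, t)\<close> is violated by all pairs of an infinite set \<open>y\<^sub>0, y\<^sub>1, \<dots>\<close>.
But the average of \<open>e + t(y\<^sub>l - y\<^sub>l\<^sub>+\<^sub>1)\<close> over \<open>l < k\<close> telescopes to
\<open>e + t(y\<^sub>0 - y\<^sub>k)/k\<close>, whose norm tends to \<open>\<parallel>e\<parallel>\<close>.\<close>

lemma exists_almost_orthogonal_difference:
  fixes x :: "nat \<Rightarrow> 'a::complex_normed_vector"
  assumes B: "\<And>n. norm (x n) \<le> B" and "compact K" "0 < \<epsilon>"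
  shows "\<exists>i j. i < j \<and> (\<forall>e\<in>K. \<forall>t. cmod t \<le> R \<longrightarrow> norm e \<le> norm (e + t *\<^sub>C (x i - x j)) + \<epsilon>)"
proof (rule ccontr)
  assume "\<not> ?thesis"
  then have neg: "\<exists>e\<in>K. \<exists>t. cmod t \<le> R \<and> norm (e + t *\<^sub>C (x i - x j)) + \<epsilon> < norm e" if "i < j" for i j
    using that by (meson not_le)
  have B0: "B \<ge> 0" using B[of 0] norm_ge_zero order_trans by blast
  \<comment> \<open>passing to a net of this mesh costs less than \<open>3/4 * \<epsilon>\<close> of the defect\<close>
  define \<rho> where "\<rho> = \<epsilon> / (4 * (1 + B))"
  have \<rho>: "\<rho> > 0" "2 * (\<rho> * (1 + B)) = \<epsilon> / 2"
    using B0 assms(3) by (auto simp: \<rho>_def field_simps)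
  have "compact (K \<times> cball (0::complex) R)" using assms(2) by (intro compact_Times) auto
  then obtain F where F: "finite F" "K \<times> cball (0::complex) R \<subseteq> (\<Union>p\<in>F. ball p \<rho>)"
    using \<rho>(1) unfolding compact_eq_totally_bounded by meson
  have net: "\<exists>p\<in>F. norm (fst p + snd p *\<^sub>C (x i - x j)) + \<epsilon> / 4 < norm (fst p)" if ij: "i < j" for i j
  proof -
    obtain e t where et: "e \<in> K" "cmod t \<le> R" "norm (e + t *\<^sub>C (x i - x j)) + \<epsilon> < norm e"
      using neg[OF ij] by blast
    then have "(e, t) \<in> K \<times> cball 0 R" by simp
    then obtain p where p: "p \<in> F" "dist p (e, t) < \<rho>" using F(2) by (meson UN_E mem_ball subsetD)
    have d1: "norm (fst p - e) < \<rho>" and d2: "cmod (snd p - t) < \<rho>"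
      using p(2) dist_fst_le[of p "(e, t)"] dist_snd_le[of p "(e, t)"] by (simp_all add: dist_norm)
    have xB: "norm (x i - x j) \<le> 2 * B"
      using norm_triangle_ineq4[of "x i" "x j"] B[of i] B[of j] by linarith
    have "fst p + snd p *\<^sub>C (x i - x j) =
        (e + t *\<^sub>C (x i - x j)) + ((fst p - e) + (snd p - t) *\<^sub>C (x i - x j))"
      by (simp add: complex_vector.scale_left_diff_distrib)
    then have "norm (fst p + snd p *\<^sub>C (x i - x j)) \<le>
        norm (e + t *\<^sub>C (x i - x j)) + norm ((fst p - e) + (snd p - t) *\<^sub>C (x i - x j))"
      by (metis norm_triangle_ineq)
    also have "norm ((fst p - e) + (snd p - t) *\<^sub>C (x i - x j)) \<le>
        norm (fst p - e) + norm ((snd p - t) *\<^sub>C (x i - x j))"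
      by (rule norm_triangle_ineq)
    also have "norm ((snd p - t) *\<^sub>C (x i - x j)) \<le> \<rho> * (2 * B)"
      unfolding norm_scaleC using d2 xB \<rho>(1) by (intro mult_mono) auto
    finally have "norm (fst p + snd p *\<^sub>C (x i - x j)) \<le> norm (e + t *\<^sub>C (x i - x j)) + (norm (fst p - e) + \<rho> * (2 * B))"
      by simp
    moreover have "norm e \<le> norm (fst p) + norm (fst p - e)"
      using norm_triangle_ineq2[of e "fst p"] by (simp add: norm_minus_commute)
    moreover have "\<rho> * (2 * B) = \<epsilon> / 2 - 2 * \<rho>"
      using \<rho>(2) by (simp add: algebra_simps)
    ultimately have "norm (fst p + snd p *\<^sub>C (x i - x j)) + \<epsilon> / 4 < norm (fst p)"
      using et(3) d1 assms(3) by linarith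
    then show ?thesis using p(1) by blast
  qed
  obtain h and s :: nat where h: "F = h ` {i. i < s}"
    using finite_imp_nat_seg_image_inj_on[OF F(1)] by blast
  define bad where "bad i j c \<longleftrightarrow> c < s \<and>
      norm (fst (h c) + snd (h c) *\<^sub>C (x i - x j)) + \<epsilon> / 4 < norm (fst (h c))" for i j c
  define col where "col E = (SOME c. bad (Min E) (Max E) c)" for E
  have bad: "bad i j (col {i, j})" if ij: "i < j" for i j
  proof -
    have "\<exists>c. bad i j c" using net[OF ij] h by (auto simp: bad_def)
    then show ?thesis using ij unfolding col_def by (simp add: someI_ex)
  qed
  have "\<forall>i\<in>UNIV. \<forall>j\<in>UNIV. i \<noteq> j \<longrightarrow> col {i, j} < s"
  proof (intro ballI impI)
    fix i j :: nat assume "i \<noteq> j"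
    then show "col {i, j} < s"
      using bad[of i j] bad[of j i] insert_commute[of i j "{}"]
      by (cases i j rule: linorder_cases) (simp_all add: bad_def)
  qed
  from Ramsey2[OF infinite_UNIV_nat this]
  obtain Y c where "infinite Y" "\<forall>i\<in>Y. \<forall>j\<in>Y. i \<noteq> j \<longrightarrow> col {i, j} = c"
    by blast
  then have Y: "infinite Y" "\<And>i j. i \<in> Y \<Longrightarrow> j \<in> Y \<Longrightarrow> i \<noteq> j \<Longrightarrow> col {i, j} = c"
    by blast+
  define e t where "e = fst (h c)" and "t = snd (h c)"
  define y where "y l = x (enumerate Y l)" for l
  have step: "norm (e + t *\<^sub>C (y l - y (Suc l))) \<le> norm e - \<epsilon> / 4" for l
  proof -
    have lt: "enumerate Y l < enumerate Y (Suc l)" using enumerate_step[OF Y(1)] .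
    then have "col {enumerate Y l, enumerate Y (Suc l)} = c"
      using Y enumerate_in_set[OF Y(1)] by (metis less_irrefl)
    then show ?thesis using bad[OF lt] by (simp add: bad_def e_def t_def y_def)
  qed
  have tele: "of_nat k *\<^sub>R e = (\<Sum>l<k. e + t *\<^sub>C (y l - y (Suc l))) - t *\<^sub>C (y 0 - y k)" for k
    by (induction k) (simp_all add: algebra_simps complex_vector.scale_right_diff_distrib)
  have "real k * (\<epsilon> / 4) \<le> cmod t * (2 * B)" for k
  proof -
    have "real k * norm e = norm (of_nat k *\<^sub>R e)" by simp
    also have "\<dots> \<le> norm (\<Sum>l<k. e + t *\<^sub>C (y l - y (Suc l))) + norm (t *\<^sub>C (y 0 - y k))"
      unfolding tele by (rule norm_triangle_ineq4)
    also have "norm (\<Sum>l<k. e + t *\<^sub>C (y l - y (Suc l))) \<le> (\<Sum>l<k. norm e - \<epsilon> / 4)"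
      by (rule sum_norm_le) (rule step)
    also have "norm (t *\<^sub>C (y 0 - y k)) \<le> cmod t * (2 * B)"
      unfolding norm_scaleC using norm_triangle_ineq4[of "y 0" "y k"] B
      by (intro mult_left_mono) (auto simp: y_def intro: order_trans[OF norm_triangle_ineq4] add_mono[of _ B _ B, simplified])
    finally show ?thesis by (simp add: algebra_simps)
  qed
  moreover obtain k where "cmod t * (2 * B) / (\<epsilon> / 4) < real k" using reals_Archimedean2 by blast
  ultimately show False using assms(3) by (metis divide_less_eq half_gt_zero_iff not_le zero_less_divide_iff zero_less_numeral)
qed

text \<open>The value \<open>1/2\<close> stands for any fixed separation; what matters is that it does not depend on \<open>\<eta>\<close>.\<close>

definition almost_null :: "('a::real_normed_vector \<Rightarrow> 'b::real_normed_vector) \<Rightarrow> bool" where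
  "almost_null S \<longleftrightarrow> (\<forall>\<eta>>0. \<exists>x. bounded (range x) \<and> (\<forall>i j. i < j \<longrightarrow> 1/2 < dist (x i) (x (j::nat)) \<and> dist (S (x i)) (S (x j)) \<le> \<eta>))"

lemma almost_null_orthogonal_unit_vector:
  assumes S: "bounded_linear S" "almost_null S" and "compact K" "0 < \<epsilon>" "0 < \<eta>"
  shows "\<exists>y::'a::complex_normed_vector. norm y = 1 \<and> norm (S y) \<le> \<eta> \<and>
    (\<forall>e\<in>K. \<forall>t. cmod t \<le> R \<longrightarrow> norm e \<le> norm (e + t *\<^sub>C y) + \<epsilon>)"
proof -
  obtain x where x: "bounded (range x)"
    "\<And>i j. i < j \<Longrightarrow> 1/2 < dist (x i) (x (j::nat))"
    "\<And>i j. i < j \<Longrightarrow> dist (S (x i)) (S (x j)) \<le> \<eta> / 2"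
    using S(2)[unfolded almost_null_def, rule_format, of "\<eta> / 2"] assms(5) by auto
  obtain B where B: "\<And>n. norm (x n) \<le> B" using x(1) unfolding bounded_iff by blast
  obtain i j where ij: "i < j"
    "\<And>e t. e \<in> K \<Longrightarrow> cmod t \<le> 2 * R \<Longrightarrow> norm e \<le> norm (e + t *\<^sub>C (x i - x j)) + \<epsilon>"
    using exists_almost_orthogonal_difference[of x B K \<epsilon> "2 * R", OF B assms(3,4)] by blast
  define z where "z = x i - x j"
  define y where "y = inverse (norm z) *\<^sub>R z"
  have z: "1/2 < norm z" "norm (S z) \<le> \<eta> / 2"
    using x(2,3)[OF ij(1)] linear_diff[OF bounded_linear.linear[OF S(1)]] by (auto simp: z_def dist_norm)
  have inv: "inverse (norm z) \<le> 2" using z(1) le_imp_inverse_le[of "1/2" "norm z"] by simp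
  have "z \<noteq> 0" using z(1) by auto
  then have "norm y = 1" by (simp add: y_def)
  moreover have "norm (S y) \<le> \<eta>"
  proof -
    have "norm (S y) = inverse (norm z) * norm (S z)"
      by (simp add: y_def linear_scale[OF bounded_linear.linear[OF S(1)]])
    also have "\<dots> \<le> 2 * (\<eta> / 2)" using inv z(2) assms(5) by (intro mult_mono) auto
    finally show ?thesis by simp
  qed
  moreover have "norm e \<le> norm (e + t *\<^sub>C y) + \<epsilon>" if e: "e \<in> K" and t: "cmod t \<le> R" for e t
  proof -
    have "t *\<^sub>C y = (t * of_real (inverse (norm z))) *\<^sub>C (x i - x j)"
      by (simp add: y_def z_def scaleC_of_real[symmetric] scaleC_scaleC del: of_real_inverse)
    moreover have "cmod (t * of_real (inverse (norm z))) \<le> 2 * R"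
    proof -
      have "cmod (t * of_real (inverse (norm z))) = cmod t * inverse (norm z)"
        by (simp add: norm_mult norm_inverse)
      also have "\<dots> \<le> R * 2" using t inv by (intro mult_mono) (auto intro: order_trans[OF norm_ge_zero])
      finally show ?thesis by simp
    qed
    ultimately show ?thesis using ij(2)[OF e] by metis
  qed
  ultimately show ?thesis by blast
qed

text \<open>The bound \<open>4\<close> is the one that the coefficients of unit vectors in the constructed sequence turn out
to satisfy: their partial sums have norm at most \<open>2\<close>, and a coefficient has the norm of a difference
of two of them.\<close>

definition coeff_box :: "(nat \<Rightarrow> 'a::complex_normed_vector) \<Rightarrow> nat \<Rightarrow> 'a set" where
  "coeff_box y n = {\<Sum>i<n. a i *\<^sub>C y i | a. \<forall>i<n. cmod (a i) \<le> 4}"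

lemma compact_coeff_box: "compact (coeff_box y n)"
proof (induction n)
  case 0
  then show ?case by (simp add: coeff_box_def)
next
  case (Suc n)
  have eq: "coeff_box y (Suc n) = {e + f | e f. e \<in> coeff_box y n \<and> f \<in> (\<lambda>c. c *\<^sub>C y n) ` cball 0 4}" (is "_ = ?R")
  proof (intro subset_antisym subsetI)
    fix v assume "v \<in> coeff_box y (Suc n)"
    then obtain a where a: "\<forall>i<Suc n. cmod (a i) \<le> 4" "v = (\<Sum>i<Suc n. a i *\<^sub>C y i)"
      by (auto simp: coeff_box_def)
    then have "(\<Sum>i<n. a i *\<^sub>C y i) \<in> coeff_box y n" "a n *\<^sub>C y n \<in> (\<lambda>c. c *\<^sub>C y n) ` cball 0 4"
      by (auto simp: coeff_box_def)
    then show "v \<in> ?R" using a(2) by auto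
  next
    fix v assume "v \<in> ?R"
    then obtain a c where a: "\<forall>i<n. cmod (a i) \<le> 4" "cmod c \<le> 4" "v = (\<Sum>i<n. a i *\<^sub>C y i) + c *\<^sub>C y n"
      by (auto simp: coeff_box_def)
    have "v = (\<Sum>i<Suc n. (a(n := c)) i *\<^sub>C y i)" using a(3) by simp
    moreover have "\<forall>i<Suc n. cmod ((a(n := c)) i) \<le> 4" using a by auto
    ultimately show "v \<in> coeff_box y (Suc n)" unfolding coeff_box_def by blast
  qed
  have "compact ((\<lambda>c. c *\<^sub>C y n) ` cball 0 4)"
    by (intro compact_continuous_image linear_continuous_on bounded_linear_scaleC_left compact_cball)
  then show ?case unfolding eq by (rule compact_sums[OF Suc])
qed

text \<open>A strictly decreasing sequence in \<open>[1, 2]\<close>: the quotients of successive weights are the small losses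
allowed at each step, and their product stays above \<open>1/2\<close>.\<close>

definition weight :: "nat \<Rightarrow> real" where
  "weight n = 1 + (1/2) ^ n"

lemma weight: "1 \<le> weight n" "weight n \<le> 2" "weight (Suc n) < weight n"
  by (auto simp: weight_def power_le_one)

lemma partial_norms_le:
  fixes s :: "nat \<Rightarrow> 'a::real_normed_vector"
  assumes "\<And>k. k < n \<Longrightarrow> weight (Suc k) * norm (s k) \<le> weight k * norm (s (Suc k))" "k \<le> n"
  shows "norm (s k) \<le> 2 * norm (s n)"
proof -
  have w: "0 < weight k" for k using weight(1)[of k] by linarith
  have "norm (s k) / weight k \<le> norm (s n) / weight n"
    using assms(2)
  proof (induction rule: inc_induct)
    case (step l)
    have "norm (s l) / weight l \<le> norm (s (Suc l)) / weight (Suc l)"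
      using assms(1)[OF step(2)] w[of l] w[of "Suc l"] by (simp add: field_simps)
    then show ?case using step(3) by (rule order_trans)
  qed simp
  then have "norm (s k) \<le> weight k * (norm (s n) / weight n)"
    using w[of k] by (simp add: field_simps)
  also have "\<dots> \<le> 2 * (norm (s n) / 1)"
    using weight w by (intro mult_mono divide_left_mono) (auto intro: less_imp_le divide_nonneg_pos)
  finally show ?thesis by simp
qed

text \<open>A sequence of unit vectors, each almost orthogonal to the bounded combinations of its predecessors,
is basic with constant at most \<open>2\<close>. By induction the unit vector \<open>t n\<close> has coefficients bounded by
\<open>4\<close>, so the hypothesis applies to it; a new coefficient above \<open>2\<close> makes the new norm at least \<open>1\<close>
by the triangle inequality alone.\<close>

lemma weighted_partial_sums_mono:
  fixes y :: "nat \<Rightarrow> 'a::complex_normed_vector"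
  assumes norm_y: "\<And>n. norm (y n) = 1"
    and sep: "\<And>n e t. e \<in> coeff_box y n \<Longrightarrow> cmod t \<le> 2 \<Longrightarrow> norm e \<le> norm (e + t *\<^sub>C y n) + (1 - weight (Suc n) / weight n)"
  shows "weight (Suc n) * norm (\<Sum>i<n. a i *\<^sub>C y i) \<le> weight n * norm (\<Sum>i<Suc n. a i *\<^sub>C y i)"
proof (induction n arbitrary: a rule: less_induct)
  case (less n)
  let ?s = "\<lambda>k. \<Sum>i<k. a i *\<^sub>C y i"
  have w: "0 < weight n" using weight(1)[of n] by linarith
  show ?case
  proof (cases "?s n = 0")
    case True
    then show ?thesis using w by simp
  next
    case False
    define r where "r = norm (?s n)"
    have r: "r > 0" using False by (simp add: r_def)
    define b where "b i = of_real (inverse r) * a i" for i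
    define t where "t k = (\<Sum>i<k. b i *\<^sub>C y i)" for k
    have t_s: "t k = inverse r *\<^sub>R ?s k" for k
      by (simp add: t_def b_def complex_vector.scale_sum_right scaleC_of_real[symmetric] scaleC_scaleC)
    then have tn: "norm (t n) = 1" using r by (simp add: r_def)
    have part: "norm (t k) \<le> 2" if "k \<le> n" for k
      using partial_norms_le[of n t k] less.IH[of _ b] that tn by (simp add: t_def)
    have "cmod (b k) \<le> 4" if "k < n" for k
    proof -
      have "cmod (b k) = norm (t (Suc k) - t k)"
        by (simp add: t_def norm_scaleC norm_y)
      also have "\<dots> \<le> norm (t (Suc k)) + norm (t k)" by (rule norm_triangle_ineq4)
      also have "\<dots> \<le> 2 + 2" using that by (intro add_mono part) auto
      finally show ?thesis by simp
    qed
    then have box: "t n \<in> coeff_box y n" unfolding t_def coeff_box_def by blast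
    have "weight (Suc n) \<le> weight n * norm (t (Suc n))"
    proof (cases "cmod (b n) \<le> 2")
      case True
      have "1 \<le> norm (t (Suc n)) + (1 - weight (Suc n) / weight n)"
        using sep[OF box True] tn by (simp add: t_def)
      then show ?thesis using w by (simp add: field_simps)
    next
      case False
      have "cmod (b n) = norm (t (Suc n) - t n)" by (simp add: t_def norm_scaleC norm_y)
      also have "\<dots> \<le> norm (t (Suc n)) + norm (t n)" by (rule norm_triangle_ineq4)
      finally have "1 \<le> norm (t (Suc n))" using False tn by simp
      then have "weight n * 1 \<le> weight n * norm (t (Suc n))" using w by (intro mult_left_mono) auto
      then show ?thesis using weight(3)[of n] by simp
    qed
    also have "norm (t (Suc n)) = norm (?s (Suc n)) / r"
      using t_s[of "Suc n"] r by (simp add: divide_inverse mult.commute)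
    finally show ?thesis using r by (simp add: r_def field_simps)
  qed
qed

lemma infinite_dimensionalI:
  fixes y :: "nat \<Rightarrow> 'a::complex_normed_vector"
  assumes indep: "\<And>n a k. (\<Sum>i<n. a i *\<^sub>C y i) = 0 \<Longrightarrow> k < n \<Longrightarrow> a k = 0"
    and sub: "range y \<subseteq> Y"
  shows "infinite_dimensional Y"
  unfolding infinite_dimensional_def
proof
  assume "\<exists>B. finite B \<and> Y \<subseteq> cspan B"
  then obtain B where B: "finite B" "Y \<subseteq> cspan B" by blast
  have inj: "inj y"
  proof (rule linorder_inj_onI)
    fix i j :: nat assume "i < j"
    show "y i \<noteq> y j"
    proof
      assume eq: "y i = y j"
      define a where "a l = (if l = i then 1 else if l = j then -1 else 0 :: complex)" for l
      have "(\<Sum>l<Suc j. a l *\<^sub>C y l) = (\<Sum>l\<in>{i, j}. a l *\<^sub>C y l)"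
        using \<open>i < j\<close> by (intro sum.mono_neutral_right) (auto simp: a_def)
      also have "\<dots> = 0" using \<open>i < j\<close> eq by (simp add: a_def)
      finally have "a i = 0" using \<open>i < j\<close> by (intro indep[of a "Suc j" i]) auto
      then show False by (simp add: a_def)
    qed
  qed auto
  define n where "n = Suc (card B)"
  have "complex_vector.independent (y ` {..<n})"
  proof (rule complex_vector.independent_if_scalars_zero)
    fix f v assume 0: "(\<Sum>x\<in>y ` {..<n}. f x *\<^sub>C x) = 0" and v: "v \<in> y ` {..<n}"
    have "(\<Sum>i<n. f (y i) *\<^sub>C y i) = 0"
      using 0 by (subst (asm) sum.reindex) (auto simp: inj_on_subset[OF inj])
    then show "f v = 0" using indep[of "\<lambda>i. f (y i)"] v by auto
  qed simp
  then have "card (y ` {..<n}) \<le> card B"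
    using complex_vector.independent_span_bound[OF B(1)] B(2) sub by blast
  then show False using card_image[OF inj_on_subset[OF inj], of "{..<n}"] by (simp add: n_def)
qed

text \<open>The subspace is the span of a basic sequence of unit vectors \<open>y n\<close> with coefficients bounded by four
times the norm. Then \<open>\<parallel>S (y n)\<parallel> \<le> \<delta> / 8 * (1/2)\<^sup>n\<close> sums up to \<open>\<parallel>S v\<parallel> \<le> \<delta> \<parallel>v\<parallel>\<close>.\<close>

lemma almost_null_subspace:
  fixes S :: "'a::complex_normed_vector \<Rightarrow> 'b::complex_normed_vector"
  assumes S: "bounded_clinear S" "almost_null S" and "\<delta> > 0"
  obtains Y where "csubspace Y" "infinite_dimensional Y" "\<And>v. v \<in> Y \<Longrightarrow> norm (S v) \<le> \<delta> * norm v"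
proof -
  have lin: "bounded_linear S" and SC: "\<And>c v. S (c *\<^sub>C v) = c *\<^sub>C S v"
    using S(1) by (auto simp: bounded_clinear_def)
  have "\<exists>y :: nat \<Rightarrow> 'a. \<forall>n. norm (y n) = 1 \<and> norm (S (y n)) \<le> \<delta> / 8 * (1/2) ^ n \<and>
      (\<forall>e\<in>coeff_box y n. \<forall>t. cmod t \<le> 2 \<longrightarrow> norm e \<le> norm (e + t *\<^sub>C y n) + (1 - weight (Suc n) / weight n))"
  proof (rule dependent_wellorder_choice)
    fix n and y :: "nat \<Rightarrow> 'a"
    have "0 < weight n" using weight(1)[of n] by linarith
    then have "0 < 1 - weight (Suc n) / weight n" using weight(3)[of n] by simp
    then show "\<exists>z. norm z = 1 \<and> norm (S z) \<le> \<delta> / 8 * (1/2) ^ n \<and>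
      (\<forall>e\<in>coeff_box y n. \<forall>t. cmod t \<le> 2 \<longrightarrow> norm e \<le> norm (e + t *\<^sub>C z) + (1 - weight (Suc n) / weight n))"
      using assms(3) by (intro almost_null_orthogonal_unit_vector[OF lin S(2) compact_coeff_box]) auto
  next
    fix z and y y' :: "nat \<Rightarrow> 'a" and n assume "\<And>k. k < n \<Longrightarrow> y k = y' k"
    then have "coeff_box y n = coeff_box y' n" unfolding coeff_box_def by (auto intro!: sum.cong)
    then show "(norm z = 1 \<and> norm (S z) \<le> \<delta> / 8 * (1/2) ^ n \<and>
      (\<forall>e\<in>coeff_box y n. \<forall>t. cmod t \<le> 2 \<longrightarrow> norm e \<le> norm (e + t *\<^sub>C z) + (1 - weight (Suc n) / weight n))) =
      (norm z = 1 \<and> norm (S z) \<le> \<delta> / 8 * (1/2) ^ n \<and>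
      (\<forall>e\<in>coeff_box y' n. \<forall>t. cmod t \<le> 2 \<longrightarrow> norm e \<le> norm (e + t *\<^sub>C z) + (1 - weight (Suc n) / weight n)))"
      by simp
  qed
  then obtain y :: "nat \<Rightarrow> 'a" where y: "\<And>n. norm (y n) = 1" "\<And>n. norm (S (y n)) \<le> \<delta> / 8 * (1/2) ^ n"
    "\<And>n e t. e \<in> coeff_box y n \<Longrightarrow> cmod t \<le> 2 \<Longrightarrow> norm e \<le> norm (e + t *\<^sub>C y n) + (1 - weight (Suc n) / weight n)"
    by blast
  have coeff: "cmod (a k) \<le> 4 * norm (\<Sum>i<n. a i *\<^sub>C y i)" if "k < n" for a n k
  proof -
    let ?s = "\<lambda>k. \<Sum>i<k. a i *\<^sub>C y i"
    have part: "norm (?s k) \<le> 2 * norm (?s n)" if "k \<le> n" for k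
      by (rule partial_norms_le[OF weighted_partial_sums_mono[OF y(1,3)] that])
    have "cmod (a k) = norm (?s (Suc k) - ?s k)"
      by (simp add: norm_scaleC y(1))
    also have "\<dots> \<le> norm (?s (Suc k)) + norm (?s k)" by (rule norm_triangle_ineq4)
    also have "\<dots> \<le> 2 * norm (?s n) + 2 * norm (?s n)" using that by (intro add_mono part) auto
    finally show ?thesis by simp
  qed
  define Y where "Y = {\<Sum>i<n. a i *\<^sub>C y i | n a. True}"
  have Y_I: "(\<Sum>i<n. a i *\<^sub>C y i) \<in> Y" for n a
    unfolding Y_def by blast
  show ?thesis
  proof (rule that[of Y])
    show "csubspace Y"
    proof (rule complex_vector.subspaceI)
      show "0 \<in> Y" using Y_I[of undefined 0] by simp
    next
      fix u v assume "u \<in> Y" "v \<in> Y"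
      then obtain n a m b where u: "u = (\<Sum>i<n. a i *\<^sub>C y i)" and v: "v = (\<Sum>i<m. b i *\<^sub>C y i)"
        unfolding Y_def by blast
      define N where "N = max n m"
      have "u = (\<Sum>i<N. (if i < n then a i else 0) *\<^sub>C y i)"
        unfolding u by (rule sum.mono_neutral_cong_left) (auto simp: N_def)
      moreover have "v = (\<Sum>i<N. (if i < m then b i else 0) *\<^sub>C y i)"
        unfolding v by (rule sum.mono_neutral_cong_left) (auto simp: N_def)
      ultimately have eq: "u + v = (\<Sum>i<N. ((if i < n then a i else 0) + (if i < m then b i else 0)) *\<^sub>C y i)"
        by (simp add: scaleC_add_left sum.distrib)
      show "u + v \<in> Y" unfolding eq by (rule Y_I)
    next
      fix c u assume "u \<in> Y"
      then obtain n a where u: "u = (\<Sum>i<n. a i *\<^sub>C y i)" unfolding Y_def by blast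
      have eq: "c *\<^sub>C u = (\<Sum>i<n. (c * a i) *\<^sub>C y i)"
        by (simp add: u complex_vector.scale_sum_right scaleC_scaleC)
      show "c *\<^sub>C u \<in> Y" unfolding eq by (rule Y_I)
    qed
    show "infinite_dimensional Y"
    proof (rule infinite_dimensionalI)
      show "a k = 0" if "(\<Sum>i<n. a i *\<^sub>C y i) = 0" "k < n" for n a k
        using coeff[OF that(2), of a] that(1) by simp
      show "range y \<subseteq> Y"
      proof
        fix v assume "v \<in> range y"
        then obtain k where "v = y k" by blast
        then have eq: "v = (\<Sum>i<Suc k. (if i = k then 1 else 0) *\<^sub>C y i)"
          by simp
        show "v \<in> Y" unfolding eq by (rule Y_I)
      qed
    qed
    show "norm (S v) \<le> \<delta> * norm v" if vY: "v \<in> Y" for v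
    proof -
      obtain n a where v: "v = (\<Sum>i<n. a i *\<^sub>C y i)" using vY unfolding Y_def by blast
      have "S v = (\<Sum>i<n. a i *\<^sub>C S (y i))"
        unfolding v using bounded_linear.linear[OF lin] by (simp add: linear_sum SC)
      then have "norm (S v) \<le> (\<Sum>i<n. cmod (a i) * norm (S (y i)))"
        by (simp add: norm_scaleC[symmetric] norm_sum)
      also have "\<dots> \<le> (\<Sum>i<n. 4 * norm v * (\<delta> / 8 * (1/2) ^ i))"
        using assms(3) by (intro sum_mono mult_mono y(2)) (auto simp: v intro!: coeff)
      also have "\<dots> = \<delta> / 2 * norm v * (\<Sum>i<n. (1/2) ^ i)"
        by (simp add: sum_distrib_left mult_ac)
      also have "\<dots> \<le> \<delta> / 2 * norm v * 2"
        using assms(3) by (intro mult_left_mono) (auto simp: sum_gp_strict)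
      finally show ?thesis by simp
    qed
  qed
qed

section \<open>Scalar perturbations that are almost null\<close>

lemma lower_modulus_greatest:
  fixes S :: "'a::complex_normed_vector \<Rightarrow> 'b::real_normed_vector"
  assumes "infinite_dimensional (UNIV :: 'a set)"
    and "\<And>M. bounded M \<Longrightarrow> noncompactness M = 1 \<Longrightarrow> c \<le> noncompactness (S ` M)"
  shows "c \<le> lower_modulus S"
proof -
  obtain M :: "'a set" where "bounded M" "noncompactness M = 1"
    using infinite_dimensional_unit_noncompactness[OF assms(1)] .
  then show ?thesis
    unfolding lower_modulus_def by (intro cInf_greatest) (use assms(2) in auto)
qed

lemma poly_modulus_lower_modulus:
  fixes T :: "'a::complex_normed_vector \<Rightarrow> 'a"
  assumes T: "bounded_clinear T" and inf: "infinite_dimensional (UNIV :: 'a set)"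
  shows "poly_modulus (\<lambda>p. lower_modulus (poly_apply T p)) (\<lambda>p. onorm (poly_apply T p))"
proof
  note lin = poly_apply_linear[OF T]
  have nonneg: "0 \<le> lower_modulus (poly_apply T p)" for p
    by (rule lower_modulus_greatest[OF inf]) (rule noncompactness_nonneg[OF bounded_linear_image[OF _ lin]])
  show "0 \<le> lower_modulus (poly_apply T p)" for p
    by (rule nonneg)
  show "0 \<le> onorm (poly_apply T p)" for p
    by (rule onorm_pos_le[OF lin])
  show "lower_modulus (poly_apply T p) * lower_modulus (poly_apply T r) \<le> lower_modulus (poly_apply T (p * r))" for p r
  proof (rule lower_modulus_greatest[OF inf])
    fix M :: "'a set" assume M: "bounded M" "noncompactness M = 1"
    have "lower_modulus (poly_apply T p) * lower_modulus (poly_apply T r)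
        \<le> lower_modulus (poly_apply T p) * noncompactness (poly_apply T r ` M)"
      using lower_modulus_le[OF lin M(1), of r] M(2) by (intro mult_left_mono nonneg) simp
    also have "\<dots> \<le> noncompactness (poly_apply T p ` poly_apply T r ` M)"
      by (rule lower_modulus_le[OF lin bounded_linear_image[OF M(1) lin]])
    also have "poly_apply T p ` poly_apply T r ` M = poly_apply T (p * r) ` M"
      by (simp add: image_image poly_apply_mult[OF T])
    finally show "lower_modulus (poly_apply T p) * lower_modulus (poly_apply T r)
        \<le> noncompactness (poly_apply T (p * r) ` M)" .
  qed
  show "lower_modulus (poly_apply T p) \<le> lower_modulus (poly_apply T r) + onorm (poly_apply T (p - r))" for p r
  proof -
    have "lower_modulus (poly_apply T p) - onorm (poly_apply T (p - r)) \<le> lower_modulus (poly_apply T r)"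
    proof (rule lower_modulus_greatest[OF inf])
      fix M :: "'a set" assume M: "bounded M" "noncompactness M = 1"
      have "lower_modulus (poly_apply T p) \<le> noncompactness (poly_apply T p ` M)"
        using lower_modulus_le[OF lin M(1), of p] M(2) by simp
      also have "poly_apply T p ` M = (\<lambda>x. poly_apply T r x + poly_apply T (p - r) x) ` M"
        by (simp add: poly_apply_add[OF T, symmetric])
      also have "noncompactness \<dots> \<le> noncompactness (poly_apply T r ` M) + noncompactness (poly_apply T (p - r) ` M)"
        by (intro noncompactness_add_le bounded_linear_image[OF M(1) lin])
      also have "noncompactness (poly_apply T (p - r) ` M) \<le> onorm (poly_apply T (p - r))"
        using noncompactness_linear_image_le[OF lin M(1), of "p - r"] M(2) by simp
      finally show "lower_modulus (poly_apply T p) - onorm (poly_apply T (p - r)) \<le> noncompactness (poly_apply T r ` M)"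
        by simp
    qed
    then show ?thesis by simp
  qed
  have const: "poly_apply T [:c:] = (\<lambda>x. c *\<^sub>C x)" for c
    by (simp add: fun_eq_iff poly_apply_pCons[OF T] poly_apply_0[OF T] clinear_0[OF T])
  show "cmod c \<le> lower_modulus (poly_apply T [:c:])" for c
  proof (cases "c = 0")
    case True
    then show ?thesis using nonneg by simp
  next
    case False
    show ?thesis
    proof (rule lower_modulus_greatest[OF inf])
      fix M :: "'a set" assume M: "bounded M" "noncompactness M = 1"
      have "M = (\<lambda>x. inverse c *\<^sub>C x) ` poly_apply T [:c:] ` M"
        using False by (simp add: const image_image scaleC_scaleC scaleC_of_real[of 1, simplified])
      moreover have "noncompactness ((\<lambda>x. inverse c *\<^sub>C x) ` poly_apply T [:c:] ` M)
          \<le> cmod (inverse c) * noncompactness (poly_apply T [:c:] ` M)"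
        by (rule noncompactness_image_le[OF bounded_linear_image[OF M(1) lin]])
          (simp_all add: dist_norm norm_scaleC complex_vector.scale_right_diff_distrib[symmetric])
      ultimately have "1 \<le> inverse (cmod c) * noncompactness (poly_apply T [:c:] ` M)"
        using M(2) by (simp only: norm_inverse)
      then show "cmod c \<le> noncompactness (poly_apply T [:c:] ` M)"
        using False by (simp add: field_simps)
    qed
  qed
  show "lower_modulus (poly_apply T 0) = 0"
  proof -
    obtain M :: "'a set" where M: "bounded M" "noncompactness M = 1"
      using infinite_dimensional_unit_noncompactness[OF inf] .
    have "poly_apply T 0 = (\<lambda>_. 0)" by (simp add: fun_eq_iff poly_apply_0[OF T])
    then have "lower_modulus (poly_apply T 0) \<le> 0"
      using lower_modulus_le[OF lin M(1), of 0] noncompactness_linear_image_le[OF lin M(1), of 0] M(2)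
      by (simp add: onorm_zero)
    then show ?thesis using nonneg[of 0] by simp
  qed
  show "onorm (poly_apply T (p + r)) \<le> onorm (poly_apply T p) + onorm (poly_apply T r)" for p r
    using onorm_triangle[OF lin lin, of p r] by (simp add: poly_apply_add[OF T, abs_def])
  show "onorm (poly_apply T (p * r)) \<le> onorm (poly_apply T p) * onorm (poly_apply T r)" for p r
    using onorm_compose[OF lin lin, of p r] by (simp add: o_def poly_apply_mult[OF T, abs_def])
  show "onorm (poly_apply T [:c:]) \<le> cmod c" for c
    by (rule onorm_bound) (simp_all add: const norm_scaleC)
qed

text \<open>Take \<open>M\<close> with \<open>\<chi>(M) = 1\<close> whose image is covered by finitely many small balls. The preimage in \<open>M\<close>
of one of them is still not covered by finitely many balls of radius \<open>1/2\<close>, hence contains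
a separated sequence.\<close>

lemma lower_modulus_zero_imp_almost_null:
  fixes S :: "'a::complex_normed_vector \<Rightarrow> 'b::real_normed_vector"
  assumes S: "bounded_linear S" "lower_modulus S = 0" and inf: "infinite_dimensional (UNIV :: 'a set)"
  shows "almost_null S"
  unfolding almost_null_def
proof (intro allI impI)
  fix \<eta> :: real assume "\<eta> > 0"
  obtain M0 :: "'a set" where M0: "bounded M0" "noncompactness M0 = 1"
    using infinite_dimensional_unit_noncompactness[OF inf] .
  have "{noncompactness (S ` M) | M. bounded M \<and> noncompactness M = 1} \<noteq> {}"
    using M0 by blast
  from cInf_lessD[OF this, of "\<eta> / 2"] S(2) \<open>\<eta> > 0\<close>
  obtain M where M: "bounded M" "noncompactness M = 1" "noncompactness (S ` M) < \<eta> / 2"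
    unfolding lower_modulus_def by auto
  obtain D where D: "finite D" "S ` M \<subseteq> (\<Union>d\<in>D. cball d (\<eta> / 2))"
    using finitely_covered_gt[OF bounded_linear_image[OF M(1) S(1)] M(3)] unfolding finitely_covered_def by blast
  have "\<exists>d\<in>D. \<not> finitely_covered (1/2) {x \<in> M. S x \<in> cball d (\<eta> / 2)}"
  proof (rule ccontr)
    assume "\<not> ?thesis"
    then have "\<forall>d\<in>D. \<exists>C. finite C \<and> {x \<in> M. S x \<in> cball d (\<eta> / 2)} \<subseteq> (\<Union>c\<in>C. cball c (1/2))"
      unfolding finitely_covered_def by blast
    then obtain C where C: "\<And>d. d \<in> D \<Longrightarrow> finite (C d)"
      "\<And>d. d \<in> D \<Longrightarrow> {x \<in> M. S x \<in> cball d (\<eta> / 2)} \<subseteq> (\<Union>c\<in>C d. cball c (1/2))"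
      by metis
    have "M \<subseteq> (\<Union>c\<in>\<Union>(C ` D). cball c (1/2))"
    proof
      fix x assume "x \<in> M"
      then obtain d where "d \<in> D" "S x \<in> cball d (\<eta> / 2)" using D(2) by blast
      then show "x \<in> (\<Union>c\<in>\<Union>(C ` D). cball c (1/2))" using C(2)[of d] \<open>x \<in> M\<close> by blast
    qed
    moreover have "finite (\<Union>(C ` D))" using C(1) D(1) by blast
    ultimately have "finitely_covered (1/2) M"
      unfolding finitely_covered_def by (intro exI conjI)
    then have "noncompactness M \<le> 1/2" by (intro noncompactness_le) auto
    then show False using M(2) by simp
  qed
  then obtain d where "\<not> finitely_covered (1/2) {x \<in> M. S x \<in> cball d (\<eta> / 2)}" by blast
  from not_covered_separated_sequence[OF this]
  obtain x where x: "\<And>n. x n \<in> {x \<in> M. S x \<in> cball d (\<eta> / 2)}" "\<And>i j. i < j \<Longrightarrow> 1/2 < dist (x i) (x (j::nat))"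
    by metis
  have "bounded (range x)" using x(1) by (intro bounded_subset[OF M(1)]) auto
  moreover have "dist (S (x i)) (S (x j)) \<le> \<eta>" for i j
    using x(1)[of i] x(1)[of j] dist_triangle3[of "S (x i)" "S (x j)" d] by simp
  ultimately show "\<exists>x. bounded (range x) \<and>
      (\<forall>i j. i < j \<longrightarrow> 1/2 < dist (x i) (x (j::nat)) \<and> dist (S (x i)) (S (x j)) \<le> \<eta>)"
    using x(2) by blast
qed

lemma exists_almost_null_shift:
  fixes T :: "'a::complex_normed_vector \<Rightarrow> 'a"
  assumes T: "bounded_clinear T" and inf: "infinite_dimensional (UNIV :: 'a set)"
  shows "\<exists>c. almost_null (\<lambda>x. T x - c *\<^sub>C x)"
proof -
  interpret poly_modulus "\<lambda>p. lower_modulus (poly_apply T p)" "\<lambda>p. onorm (poly_apply T p)"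
    by (rule poly_modulus_lower_modulus[OF assms])
  obtain c where "lower_modulus (poly_apply T [:- c, 1:]) = 0"
    using exists_zero by blast
  then have "almost_null (poly_apply T [:- c, 1:])"
    by (rule lower_modulus_zero_imp_almost_null[OF poly_apply_linear[OF T] _ inf])
  moreover have "poly_apply T [:- c, 1:] = (\<lambda>x. T x - c *\<^sub>C x)"
    by (simp add: fun_eq_iff poly_apply_pCons[OF T] poly_apply_0[OF T] clinear_0[OF T]
        scaleC_of_real[of 1, simplified])
  ultimately show ?thesis by metis
qed

lemma basic_sequence_infinite_dimensional:
  fixes x :: "nat \<Rightarrow> 'a::complex_normed_vector"
  assumes "basic_sequence x"
  shows "infinite_dimensional (UNIV :: 'a set)"
proof (rule infinite_dimensionalI)
  fix n a k assume 0: "(\<Sum>i<n. a i *\<^sub>C x (Suc i)) = 0" and "k < n"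
  have "0 \<in> closed_cspan (x ` {1..})"
    unfolding closed_cspan_def using complex_vector.span_zero closure_subset by blast
  then have "\<exists>!a. (\<lambda>n. a n *\<^sub>C x (Suc n)) sums 0"
    using assms unfolding basic_sequence_def by blast
  then have uniq: "b = c"
    if "(\<lambda>n. b n *\<^sub>C x (Suc n)) sums 0" "(\<lambda>n. c n *\<^sub>C x (Suc n)) sums 0" for b c
    using that by blast
  have "(\<lambda>i. (if i < n then a i else 0) *\<^sub>C x (Suc i)) sums (\<Sum>i<n. (if i < n then a i else 0) *\<^sub>C x (Suc i))"
    by (rule sums_finite) auto
  then have "(\<lambda>i. (if i < n then a i else 0) *\<^sub>C x (Suc i)) sums 0"
    using 0 by simp
  moreover have "(\<lambda>i. (\<lambda>_. 0) i *\<^sub>C x (Suc i)) sums 0" by simp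
  ultimately have "(\<lambda>i. if i < n then a i else 0) = (\<lambda>_. 0)"
    by (rule uniq)
  then show "a k = 0" using \<open>k < n\<close> by (metis (full_types))
qed simp

section \<open>Strict singularity in hereditarily indecomposable spaces\<close>

text \<open>With \<open>y\<close> a unit vector of a subspace on which \<open>S\<close> is bounded by \<open>\<epsilon>/4\<close>, and \<open>z\<close> within \<open>\<delta>\<close> of
\<open>y\<close>, both \<open>\<parallel>S y\<parallel>\<close> and \<open>\<parallel>S (z - y)\<parallel>\<close> are at most \<open>\<epsilon>/4\<close>, while \<open>\<parallel>z\<parallel> > 1/2\<close>.\<close>

lemma schreier_SS_of_almost_null:
  fixes S :: "'a::cbanach \<Rightarrow> 'a"
  assumes HI: "schreier_HI \<sigma> \<xi> TYPE('a)" and S: "bounded_clinear S" "almost_null S"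
  shows "S \<in> schreier_SS \<sigma> \<xi>"
  unfolding schreier_SS_def
proof (intro CollectI conjI allI impI)
  show "bounded_clinear S" by fact
  fix \<epsilon> :: real and x :: "nat \<Rightarrow> 'a" assume "\<epsilon> > 0" and x: "basic_sequence x"
  have lin: "bounded_linear S" using S(1) by (simp add: bounded_clinear_def)
  have N: "onorm S \<ge> 0" by (rule onorm_pos_le[OF lin])
  define \<delta> where "\<delta> = min (1/2) (\<epsilon> / (4 * (onorm S + 1)))"
  have \<delta>: "\<delta> > 0" "\<delta> \<le> 1/2" "onorm S * \<delta> \<le> \<epsilon> / 4"
  proof -
    show "\<delta> > 0" using \<open>\<epsilon> > 0\<close> N by (simp add: \<delta>_def)
    show "\<delta> \<le> 1/2" unfolding \<delta>_def by (rule min.cobounded1)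
    have "onorm S * \<delta> \<le> (onorm S + 1) * (\<epsilon> / (4 * (onorm S + 1)))"
      using N \<open>\<epsilon> > 0\<close> \<open>\<delta> > 0\<close> by (intro mult_mono) (auto simp: \<delta>_def)
    also have "\<dots> = \<epsilon> / 4" using N by (simp add: divide_simps)
    finally show "onorm S * \<delta> \<le> \<epsilon> / 4" .
  qed
  obtain Y where Y: "csubspace Y" "infinite_dimensional Y" "\<And>v. v \<in> Y \<Longrightarrow> norm (S v) \<le> \<epsilon> / 4 * norm v"
    using almost_null_subspace[OF S, of "\<epsilon> / 4"] \<open>\<epsilon> > 0\<close> by (metis divide_pos_pos zero_less_numeral)
  then obtain F y where F: "F \<in> schreier \<sigma> \<xi>" and y: "y \<in> Y" "norm y = 1"
    and dist: "infdist y (closed_cspan (x ` F)) < \<delta>"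
    using HI x \<delta>(1) unfolding schreier_HI_def by blast
  have "closed_cspan (x ` F) \<noteq> {}"
    unfolding closed_cspan_def using complex_vector.span_zero closure_subset by blast
  with dist obtain z where z: "z \<in> closed_cspan (x ` F)" "dist y z < \<delta>"
    by (metis cINF_less_iff bdd_below_image_dist infdist_notempty)
  have "norm y \<le> norm z + dist y z" using norm_triangle_sub[of y z] by (simp add: dist_norm)
  then have nz: "1/2 < norm z" using z(2) \<delta>(2) y(2) by simp
  have "norm (S z) \<le> norm (S y) + norm (S (z - y))"
    using norm_triangle_ineq[of "S y" "S (z - y)"] linear_diff[OF bounded_linear.linear[OF lin]] by simp
  also have "\<dots> \<le> \<epsilon> / 4 + onorm S * norm (z - y)"
    using Y(3)[OF y(1)] y(2) onorm[OF lin, of "z - y"] by simp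
  also have "\<dots> \<le> \<epsilon> / 4 + onorm S * \<delta>"
    using z(2) N by (intro add_left_mono mult_left_mono) (auto simp: dist_norm norm_minus_commute)
  also have "\<dots> \<le> \<epsilon> * (1/2)" using \<delta>(3) by simp
  also have "\<dots> \<le> \<epsilon> * norm z" using nz \<open>\<epsilon> > 0\<close> by (intro mult_left_mono) auto
  finally show "\<exists>F\<in>schreier \<sigma> \<xi>. \<exists>z\<in>closed_cspan (x ` F) - {0}. norm (S z) \<le> \<epsilon> * norm z"
    using F z(1) nz by (intro bexI[of _ F] bexI[of _ z]) auto
qed

text \<open>A space carrying a basic sequence is infinite-dimensional; a space without one makes every bounded
operator strictly singular.\<close>

theorem proposition6p11:
  fixes \<sigma> :: "omega1 \<Rightarrow> nat \<Rightarrow> omega1"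
    and \<xi> :: omega1
    and T :: "'a::cbanach \<Rightarrow> 'a"
  assumes "fundamental_system \<sigma>"
    and "1 \<le> \<xi>"
    and "schreier_HI \<sigma> \<xi> TYPE('a)"
    and "bounded_clinear T"
  shows "\<exists>(c::complex) S. S \<in> schreier_SS \<sigma> \<xi> \<and> T = (\<lambda>x. c *\<^sub>C x + S x)"
proof (cases "\<exists>x :: nat \<Rightarrow> 'a. basic_sequence x")
  case True
  then obtain c where c: "almost_null (\<lambda>x. T x - c *\<^sub>C x)"
    using exists_almost_null_shift[OF assms(4)] basic_sequence_infinite_dimensional by blast
  have "bounded_clinear (\<lambda>x. T x - c *\<^sub>C x)"
    using assms(4) unfolding bounded_clinear_def
    by (auto intro!: bounded_linear_sub bounded_linear_scaleC_right
        simp: complex_vector.scale_right_diff_distrib scaleC_scaleC mult.commute)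
  then have "(\<lambda>x. T x - c *\<^sub>C x) \<in> schreier_SS \<sigma> \<xi>"
    using schreier_SS_of_almost_null[OF assms(3)] c by blast
  then show ?thesis
    by (intro exI[of _ c] exI[of _ "\<lambda>x. T x - c *\<^sub>C x"]) simp
next
  case False
  then have "T \<in> schreier_SS \<sigma> \<xi>"
    using assms(4) by (simp add: schreier_SS_def)
  then show ?thesis
    by (intro exI[of _ 0] exI[of _ T]) simp
qed

end
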